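(* Let $E\subset\mathbb{R}^d$ be a non-empty compact set. Then $$\underline{\dim}_{\rm MB}E=\sup_{F\subset E}\ \inf_{\{R_k\}_k\nearrow\infty}\ \sup_{\mu:\,\mathrm{spt}\,\mu=F}\ \limsup_{k\to\infty}\frac{\log\Big(R_k^{-d}\int_{|z|\le R_k}|\widehat{\mu}(z)|^2\,dz\Big)}{-\log R_k},$$ where the outer supremum is over non-empty compact sets $F\subset E$, the infimum is over all sequences $\{R_k\}_k$ of positive reals increasing to $\infty$, and the inner supremum is over finite Borel measures $\mu$ on $\mathbb{R}^d$ with $\mathrm{spt}\,\mu=F$.
   Context: $\mathrm{spt}\,\mu$ is the (closed) support of $\mu$. The Fourier transform of a finite Borel measure $\mu$ is $\widehat{\mu}(z)=\int e^{i x\cdot z}\,d\mu(x)$, $z\in\mathbb{R}^d$. For non-empty bounded $A\subset\mathbb{R}^d$ and $r>0$, $N_r(A)$ is the least number of sets of diameter $r$ that can cover $A$, and $\underline{\dim}_{\rm B}A=\liminf_{r\to0}\frac{\log N_r(A)}{-\log r}$. The modified lower box dimension is $$\underline{\dim}_{\rm MB}E=\inf\Big\{\sup_i\underline{\dim}_{\rm B}E_i:\ E\subset\bigcup_{i=1}^\infty E_i,\ E_i\text{ (non-empty) compact}\Big\},$$ the infimum being over all countable covers of $E$ by compact sets. *)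

theory Defs
  imports "HOL-Analysis.Analysis"
begin

definition finite_borel_measure :: "'a::topological_space measure \<Rightarrow> bool" where
  "finite_borel_measure \<mu> \<longleftrightarrow> sets \<mu> = sets borel \<and> finite_measure \<mu>"

definition spt :: "'a::topological_space measure \<Rightarrow> 'a set" where
  "spt \<mu> = {x. \<forall>U. open U \<longrightarrow> x \<in> U \<longrightarrow> 0 < emeasure \<mu> U}"

definition fourier :: "'a::euclidean_space measure \<Rightarrow> 'a \<Rightarrow> complex" where
  "fourier \<mu> z = (LINT x|\<mu>. exp (\<i> * complex_of_real (x \<bullet> z)))"

text \<open>
  Covering sets have diameter exactly \<open>r\<close>; since every nonempty set of diameter at most \<open>r\<close> in a
  Euclidean space of positive dimension lies in a set of diameter \<open>r\<close>, requiring at most \<open>r\<close>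
  would give the same number. Boundedness is stated because \<^const>\<open>diameter\<close> is unspecified on
  unbounded sets.
\<close>
definition covering_number :: "real \<Rightarrow> 'a::euclidean_space set \<Rightarrow> nat" where
  "covering_number r A =
     (LEAST n. \<exists>\<C>. finite \<C> \<and> card \<C> = n \<and> (\<forall>U\<in>\<C>. bounded U \<and> diameter U = r) \<and> A \<subseteq> \<Union>\<C>)"

definition lower_box_dim :: "'a::euclidean_space set \<Rightarrow> ereal" where
  "lower_box_dim A =
     Liminf (at_right 0) (\<lambda>r. ereal (ln (real (covering_number r A)) / (- ln r)))"

definition modified_lower_box_dim :: "'a::euclidean_space set \<Rightarrow> ereal" where
  "modified_lower_box_dim E =
     (INF K \<in> {K :: nat \<Rightarrow> 'a set. (\<forall>i. compact (K i) \<and> K i \<noteq> {}) \<and> E \<subseteq> (\<Union>i. K i)}.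
        SUP i. lower_box_dim (K i))"

end

theory Submission
  imports "HOL-Real_Asymp.Real_Asymp" "HOL-Probability.Characteristic_Functions" Defs
begin

text \<open>
  The decay of the averages \<open>R\<^bsup>-d\<^esup> \<integral> |\<mu>^(z)|\<^sup>2\<close> over the ball \<open>|z| \<le> R\<close> measures how much \<open>\<mu>\<close> concentrates
  at scale \<open>1/R\<close>: up to constants and rapidly decaying errors the average is the Gaussian energy
  \<open>\<integral>\<integral> exp (- s\<^sup>2|x - y|\<^sup>2 / 2) d\<mu>(x) d\<mu>(y)\<close>, because the Fourier transform of a Gaussian is a
  Gaussian. The comparison from above holds with \<open>s = R\<close>; the one from below takes \<open>s\<close> slightly smaller
  than \<open>R\<close>, so that the part of the frequency Gaussian outside the ball is negligible. Since only
  logarithms divided by \<open>ln R\<close> matter, a loss of a factor \<open>R\<^bsup>\<epsilon>\<^esup>\<close> in the scale is harmless.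

  For the inequality from right to left, let compact sets \<open>K i\<close> cover \<open>E\<close>, hence also \<open>F\<close>. By Baire's theorem
  some \<open>K i\<close> contains a relatively open piece \<open>U \<inter> F\<close> of \<open>F\<close>. Let the \<open>R k\<close> follow scales \<open>r\<close> that realise the lower box
  dimension of this \<open>K i\<close>. Every \<open>\<mu>\<close> with support \<open>F\<close> gives \<open>U \<inter> F\<close> positive mass, and by Cauchy--Schwarz a
  mass covered by \<open>N\<close> sets of diameter \<open>r\<close> has energy at least of order \<open>1/N\<close> at scale \<open>r\<close>. So the
  exponent cannot exceed the lower box dimension of \<open>K i\<close>, for all \<open>\<mu>\<close> along the same \<open>R k\<close>
  (\<open>limsup_fourier_decay_le\<close>).

  For the other inequality let \<open>s\<close> be below the modified dimension. Removing from \<open>E\<close> every basic open set in which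
  \<open>E\<close> is a countable union of pieces of dimension at most \<open>s\<close> leaves a non-empty compact \<open>F\<close> all of whose relatively open
  pieces have lower box dimension above \<open>s\<close> (\<open>essential_part\<close>). Hence every such piece contains at least \<open>r\<^bsup>-s\<^esup>\<close>
  points with mutual distances above \<open>r\<close>, for all small \<open>r\<close>. Given any \<open>R k\<close>, a measure is built as the
  law of a limit of simple functions on \<open>[0,1)\<close>: again and again each value is split into \<open>r\<^bsup>-s\<^esup>\<close> separated
  values close to it, where \<open>r\<close> belongs to some \<open>R k\<close> chosen late enough, and so late that later steps move
  points by less than a fraction of \<open>r\<close>. Doing this in countably many neighbourhoods at once and mixing the laws
  with rapidly decreasing weights gives a measure with support exactly \<open>F\<close> that gives every ball of the
  chosen scales a small mass (\<open>measure_spreading_along_scales\<close>), hence small energy along infinitely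
  many \<open>R k\<close>.
\<close>

section \<open>The Gaussian and its Fourier transform\<close>

text \<open>
  The substitution \<open>z = s u\<close> turns the integral into the characteristic function of the standard
  normal distribution.
\<close>

lemma gaussian_fourier_real:
  fixes s x :: real
  assumes "s > 0"
  shows "integrable lborel (\<lambda>z. exp (- (z / s)\<^sup>2 / 2) * exp (\<i> * complex_of_real (x * z)))" (is "integrable _ ?f")
    and "(LINT z|lborel. exp (- (z / s)\<^sup>2 / 2) * exp (\<i> * complex_of_real (x * z)))
           = complex_of_real (s * sqrt (2 * pi) * exp (- (s * x)\<^sup>2 / 2))"
proof -
  have eq: "?f (0 + s * u) = complex_of_real (sqrt (2 * pi)) * (std_normal_density u *\<^sub>R iexp (s * x * u))" for u
    using assms by (simp add: normal_density_def scaleR_conv_of_real algebra_simps)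
  have int: "integrable lborel (\<lambda>u. std_normal_density u *\<^sub>R iexp (s * x * u))"
  proof (rule Bochner_Integration.integrable_bound)
    show "integrable lborel std_normal_density"
      by simp
  qed (auto simp: norm_mult)
  have "integrable lborel (\<lambda>u. ?f (0 + s * u))"
    unfolding eq using int by (intro integrable_mult_right)
  then show "integrable lborel ?f"
    using lborel_integrable_real_affine_iff[of s ?f 0] assms by simp
  have "(LINT u|lborel. std_normal_density u *\<^sub>R iexp (s * x * u)) = char std_normal_distribution (s * x)"
    unfolding char_def by (subst integral_density) auto
  also have "\<dots> = complex_of_real (exp (- (s * x)\<^sup>2 / 2))"
    by (simp add: char_std_normal_distribution)
  finally have 1: "(LINT u|lborel. std_normal_density u *\<^sub>R iexp (s * x * u)) = complex_of_real (exp (- (s * x)\<^sup>2 / 2))" .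
  have "(LINT z|lborel. ?f z) = s *\<^sub>R (LINT u|lborel. ?f (0 + s * u))"
    using lborel_integral_real_affine[of s ?f 0] assms by simp
  also have "\<dots> = complex_of_real (s * sqrt (2 * pi) * exp (- (s * x)\<^sup>2 / 2))"
    unfolding eq using 1 by (simp add: scaleR_conv_of_real)
  finally show "(LINT z|lborel. ?f z) = complex_of_real (s * sqrt (2 * pi) * exp (- (s * x)\<^sup>2 / 2))" .
qed

text \<open>
  The integrand is a product of one-dimensional integrands over the coordinates, and Lebesgue measure
  is the image of a product measure.
\<close>

lemma gaussian_fourier:
  fixes x :: "'a::euclidean_space"
  assumes "s > 0"
  shows "integrable lborel (\<lambda>z. complex_of_real (exp (- (norm z / s)\<^sup>2 / 2)) * exp (\<i> * complex_of_real (x \<bullet> z)))" (is "integrable _ ?f")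
    and "(LINT z|lborel. complex_of_real (exp (- (norm z / s)\<^sup>2 / 2)) * exp (\<i> * complex_of_real (x \<bullet> z)))
           = complex_of_real ((s * sqrt (2 * pi)) ^ DIM('a) * exp (- (s * norm x)\<^sup>2 / 2))"
proof -
  define h where "h = (\<lambda>b t. complex_of_real (exp (- (t / s)\<^sup>2 / 2)) * exp (\<i> * complex_of_real ((x \<bullet> b) * t)))"
  interpret product_sigma_finite "\<lambda>_::'a. lborel :: real measure" ..
  have normsq: "(norm z)\<^sup>2 = (\<Sum>b\<in>Basis. (z \<bullet> b)\<^sup>2)" for z :: 'a
    unfolding power2_norm_eq_inner by (subst euclidean_inner) (simp add: power2_eq_square)
  have f_prod: "?f z = (\<Prod>b\<in>Basis. h b (z \<bullet> b))" for z :: 'a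
  proof -
    have "(norm z / s)\<^sup>2 = (\<Sum>b\<in>Basis. (z \<bullet> b / s)\<^sup>2)"
      by (simp add: power_divide normsq sum_divide_distrib)
    then have "exp (- (norm z / s)\<^sup>2 / 2) = (\<Prod>b\<in>Basis. exp (- (z \<bullet> b / s)\<^sup>2 / 2))"
      by (simp add: exp_sum[symmetric] sum_negf sum_divide_distrib)
    moreover have "exp (\<i> * complex_of_real (x \<bullet> z)) = (\<Prod>b\<in>Basis. exp (\<i> * complex_of_real ((x \<bullet> b) * (z \<bullet> b))))"
      by (subst euclidean_inner) (simp add: exp_sum[symmetric] sum_distrib_left)
    ultimately show ?thesis
      by (simp add: h_def prod.distrib)
  qed
  have coord: "(\<Sum>b\<in>Basis. f b *\<^sub>R b) \<bullet> c = f c" if "c \<in> Basis" for f and c :: 'a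
    using that by (simp add: inner_sum_left inner_Basis if_distrib cong: if_cong)
  have hint: "integrable lborel (h b)" and hval: "(LINT t|lborel. h b t) = complex_of_real (s * sqrt (2 * pi) * exp (- (s * (x \<bullet> b))\<^sup>2 / 2))" for b
    using gaussian_fourier_real[OF assms, of "x \<bullet> b"] by (simp_all add: h_def)
  have f_coord: "?f (\<Sum>b\<in>Basis. y b *\<^sub>R b) = (\<Prod>b\<in>Basis. h b (y b))" for y
    unfolding f_prod by (simp add: coord)
  have [measurable]: "?f \<in> borel_measurable borel" "(\<lambda>y. \<Sum>b\<in>Basis. y b *\<^sub>R b :: 'a) \<in> (\<Pi>\<^sub>M b\<in>Basis. lborel) \<rightarrow>\<^sub>M borel"
    by measurable
  show "integrable lborel ?f"
    by (subst lborel_eq, subst integrable_distr_eq)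
      (auto simp only: f_coord intro!: product_integrable_prod hint, measurable)
  have "(LINT z|lborel. ?f z) = (LINT y|(\<Pi>\<^sub>M b\<in>Basis. lborel). ?f (\<Sum>b\<in>Basis. y b *\<^sub>R b))"
    by (subst lborel_eq, subst integral_distr) (simp_all only: measurable_lborel1, measurable)
  also have "\<dots> = (\<Prod>b\<in>Basis. (LINT t|lborel. h b t))"
    unfolding f_coord by (intro product_integral_prod hint) auto
  also have "\<dots> = complex_of_real (\<Prod>b\<in>Basis. s * sqrt (2 * pi) * exp (- (s * (x \<bullet> b))\<^sup>2 / 2))"
    by (simp add: hval)
  also have "(\<Prod>b\<in>Basis. s * sqrt (2 * pi) * exp (- (s * (x \<bullet> b))\<^sup>2 / 2))
      = (s * sqrt (2 * pi)) ^ DIM('a) * exp (\<Sum>b\<in>Basis. - (s * (x \<bullet> b))\<^sup>2 / 2)"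
    by (simp add: prod.distrib exp_sum)
  also have "(\<Sum>b\<in>Basis. - (s * (x \<bullet> b))\<^sup>2 / 2) = - (s * norm x)\<^sup>2 / 2"
    by (simp add: power_mult_distrib normsq sum_negf sum_divide_distrib sum_distrib_left)
  finally show "(LINT z|lborel. ?f z) = complex_of_real ((s * sqrt (2 * pi)) ^ DIM('a) * exp (- (s * norm x)\<^sup>2 / 2))" .
qed

lemma gaussian_integral:
  assumes "s > 0"
  shows "integrable lborel (\<lambda>z::'a::euclidean_space. exp (- (norm z / s)\<^sup>2 / 2))"
    and "(LINT z|lborel. exp (- (norm (z::'a) / s)\<^sup>2 / 2)) = (s * sqrt (2 * pi)) ^ DIM('a)"
proof -
  have 1: "integrable lborel (\<lambda>z::'a. complex_of_real (exp (- (norm z / s)\<^sup>2 / 2)))"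
    using gaussian_fourier(1)[OF assms, of "0::'a"] by simp
  then show "integrable lborel (\<lambda>z::'a::euclidean_space. exp (- (norm z / s)\<^sup>2 / 2))"
    by (simp only: complex_of_real_integrable_eq)
  have "complex_of_real (LINT z|lborel. exp (- (norm (z::'a) / s)\<^sup>2 / 2)) = complex_of_real ((s * sqrt (2 * pi)) ^ DIM('a))"
    using gaussian_fourier(2)[OF assms, of "0::'a"] by (simp only: integral_complex_of_real[symmetric]) simp
  then show "(LINT z|lborel. exp (- (norm (z::'a) / s)\<^sup>2 / 2)) = (s * sqrt (2 * pi)) ^ DIM('a)"
    by (simp only: of_real_eq_iff)
qed

definition gaussian_energy :: "real \<Rightarrow> 'a::euclidean_space measure \<Rightarrow> real" where
  "gaussian_energy s \<mu> = (LINT x|\<mu>. LINT y|\<mu>. exp (- (s * dist x y)\<^sup>2 / 2))"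

lemma finite_borel_measureD:
  assumes "finite_borel_measure \<mu>"
  shows "sets \<mu> = sets borel" "space \<mu> = UNIV" "finite_measure \<mu>"
  using assms sets_eq_imp_space_eq[of \<mu> borel] by (auto simp: finite_borel_measure_def)

lemma measurable_fourier:
  fixes \<mu> :: "'a::euclidean_space measure"
  assumes "finite_borel_measure \<mu>"
  shows "fourier \<mu> \<in> borel_measurable borel"
proof -
  interpret finite_measure \<mu> using finite_borel_measureD[OF assms] by simp
  have [measurable_cong]: "sets \<mu> = sets borel" using finite_borel_measureD[OF assms] by simp
  show ?thesis unfolding fourier_def[abs_def] by measurable
qed

lemma norm_fourier_le:
  fixes \<mu> :: "'a::euclidean_space measure"
  assumes "finite_borel_measure \<mu>"
  shows "cmod (fourier \<mu> z) \<le> measure \<mu> UNIV"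
proof -
  interpret finite_measure \<mu> using finite_borel_measureD[OF assms] by simp
  have [measurable_cong]: "sets \<mu> = sets borel" and sp: "space \<mu> = UNIV"
    using finite_borel_measureD[OF assms] by simp_all
  have "cmod (fourier \<mu> z) \<le> (LINT x|\<mu>. cmod (exp (\<i> * complex_of_real (x \<bullet> z))))"
    unfolding fourier_def by (rule integral_norm_bound)
  also have "\<dots> = measure \<mu> UNIV" by (simp add: sp)
  finally show ?thesis .
qed

text \<open>
  Expanding \<open>|\<mu>^(z)|\<^sup>2\<close> as a double integral of \<open>exp (i (x - y) \<cdot> z)\<close> and exchanging the order of
  integration puts the Gaussian Fourier transform at \<open>x - y\<close> inside; this is how concentration of \<open>\<mu>\<close> is
  read off from \<open>\<mu>^\<close>.
\<close>

lemma gaussian_weighted_fourier: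
  fixes \<mu> :: "'a::euclidean_space measure"
  assumes mu: "finite_borel_measure \<mu>" and s: "s > 0"
  shows "integrable lborel (\<lambda>z. exp (- (norm z / s)\<^sup>2 / 2) * (cmod (fourier \<mu> z))\<^sup>2)"
    and "(LINT z|lborel. exp (- (norm z / s)\<^sup>2 / 2) * (cmod (fourier \<mu> z))\<^sup>2)
           = (s * sqrt (2 * pi)) ^ DIM('a) * gaussian_energy s \<mu>"
proof -
  interpret finite_measure \<mu> using finite_borel_measureD[OF mu] by simp
  have [measurable_cong]: "sets \<mu> = sets borel" and sp[simp]: "space \<mu> = UNIV"
    using finite_borel_measureD[OF mu] by simp_all
  interpret P: pair_sigma_finite \<mu> \<mu> ..
  interpret PP: finite_measure "\<mu> \<Otimes>\<^sub>M \<mu>" by (rule finite_measure_pair_measure) unfold_locales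
  interpret Q: pair_sigma_finite "lborel :: 'a measure" "\<mu> \<Otimes>\<^sub>M \<mu>" ..
  note measurable_fourier[OF mu, measurable]
  define g where "g = (\<lambda>z::'a. exp (- (norm z / s)\<^sup>2 / 2))"
  have [measurable]: "g \<in> borel_measurable borel" unfolding g_def by measurable
  have gint: "integrable lborel g" unfolding g_def by (rule gaussian_integral[OF s])
  show int: "integrable lborel (\<lambda>z. exp (- (norm z / s)\<^sup>2 / 2) * (cmod (fourier \<mu> z))\<^sup>2)"
  proof (rule Bochner_Integration.integrable_bound)
    show "integrable lborel (\<lambda>z. g z * (measure \<mu> UNIV)\<^sup>2)" using gint by simp
    show "AE z in lborel. norm (exp (- (norm z / s)\<^sup>2 / 2) * (cmod (fourier \<mu> z))\<^sup>2) \<le> norm (g z * (measure \<mu> UNIV)\<^sup>2)"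
      using norm_fourier_le[OF mu] by (auto simp: g_def norm_mult intro!: mult_left_mono power_mono)
  qed measurable
  define e where "e = (\<lambda>(z::'a) (x::'a). exp (\<i> * complex_of_real (x \<bullet> z)))"
  have [measurable]: "cnj \<in> borel_measurable borel"
    by (intro borel_measurable_continuous_onI continuous_intros)
  have [measurable]: "case_prod e \<in> borel_measurable (borel \<Otimes>\<^sub>M borel)"
    unfolding e_def by measurable
  have esub: "e z (x - y) = e z x * cnj (e z y)" for z x y
    by (simp add: e_def exp_cnj algebra_simps flip: exp_add)
  have eint: "integrable \<mu> (e z)" for z
    by (rule integrable_const_bound[where B=1]) (auto simp: e_def)
  have mod2: "complex_of_real ((cmod (fourier \<mu> z))\<^sup>2) = (LINT p|(\<mu> \<Otimes>\<^sub>M \<mu>). e z (fst p - snd p))" for z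
  proof -
    have "complex_of_real ((cmod (fourier \<mu> z))\<^sup>2) = (LINT x|\<mu>. e z x) * cnj (LINT y|\<mu>. e z y)"
      by (simp add: complex_norm_square fourier_def e_def del: of_real_power)
    also have "\<dots> = (LINT x|\<mu>. LINT y|\<mu>. e z x * cnj (e z y))"
      by (simp add: eint)
    also have "\<dots> = (LINT p|(\<mu> \<Otimes>\<^sub>M \<mu>). e z (fst p) * cnj (e z (snd p)))"
    proof (subst P.integral_fst'[symmetric])
      show "integrable (\<mu> \<Otimes>\<^sub>M \<mu>) (\<lambda>p. e z (fst p) * cnj (e z (snd p)))"
      proof (rule PP.integrable_const_bound[where B=1])
        show "(\<lambda>p. e z (fst p) * cnj (e z (snd p))) \<in> borel_measurable (\<mu> \<Otimes>\<^sub>M \<mu>)"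
          by measurable
      qed (simp add: e_def norm_mult)
    qed simp
    finally show ?thesis by (simp add: esub)
  qed
  have kint: "integrable (lborel \<Otimes>\<^sub>M (\<mu> \<Otimes>\<^sub>M \<mu>)) (\<lambda>(z, p). complex_of_real (g z) * e z (fst p - snd p))"
  proof (rule Q.Fubini_integrable)
    show "integrable lborel (\<lambda>z. LINT p|(\<mu> \<Otimes>\<^sub>M \<mu>). norm (case (z, p) of (z, p) \<Rightarrow> complex_of_real (g z) * e z (fst p - snd p)))"
      using gint by (simp add: norm_mult e_def g_def)
    show "AE z in lborel. integrable (\<mu> \<Otimes>\<^sub>M \<mu>) (\<lambda>p. case (z, p) of (z, p) \<Rightarrow> complex_of_real (g z) * e z (fst p - snd p))"
    proof (intro AE_I2)
      fix z :: 'a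
      show "integrable (\<mu> \<Otimes>\<^sub>M \<mu>) (\<lambda>p. case (z, p) of (z, p) \<Rightarrow> complex_of_real (g z) * e z (fst p - snd p))"
        by (rule PP.integrable_const_bound[where B="g z"]) (auto simp: e_def norm_mult g_def)
    qed
  qed measurable
  have "complex_of_real (LINT z|lborel. g z * (cmod (fourier \<mu> z))\<^sup>2)
      = (LINT z|lborel. LINT p|(\<mu> \<Otimes>\<^sub>M \<mu>). complex_of_real (g z) * e z (fst p - snd p))"
    by (simp add: mod2 flip: integral_complex_of_real del: of_real_power)
  also have "\<dots> = (LINT p|(\<mu> \<Otimes>\<^sub>M \<mu>). LINT z|lborel. complex_of_real (g z) * e z (fst p - snd p))"
    by (rule Q.Fubini_integral[symmetric]) (rule kint)
  also have "\<dots> = (LINT p|(\<mu> \<Otimes>\<^sub>M \<mu>). complex_of_real ((s * sqrt (2 * pi)) ^ DIM('a) * exp (- (s * norm (fst p - snd p))\<^sup>2 / 2)))"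
    unfolding g_def e_def by (subst gaussian_fourier(2)[OF s]) simp
  also have "\<dots> = complex_of_real (LINT p|(\<mu> \<Otimes>\<^sub>M \<mu>). (s * sqrt (2 * pi)) ^ DIM('a) * exp (- (s * norm (fst p - snd p))\<^sup>2 / 2))"
    by (rule integral_complex_of_real)
  also have "(LINT p|(\<mu> \<Otimes>\<^sub>M \<mu>). (s * sqrt (2 * pi)) ^ DIM('a) * exp (- (s * norm (fst p - snd p))\<^sup>2 / 2))
      = (s * sqrt (2 * pi)) ^ DIM('a) * (LINT p|(\<mu> \<Otimes>\<^sub>M \<mu>). exp (- (s * norm (fst p - snd p))\<^sup>2 / 2))"
    by simp
  also have "(LINT p|(\<mu> \<Otimes>\<^sub>M \<mu>). exp (- (s * norm (fst p - snd p))\<^sup>2 / 2)) = gaussian_energy s \<mu>"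
    unfolding gaussian_energy_def
  proof (subst P.integral_fst'[symmetric])
    show "integrable (\<mu> \<Otimes>\<^sub>M \<mu>) (\<lambda>p. exp (- (s * norm (fst p - snd p))\<^sup>2 / 2))"
      by (rule PP.integrable_const_bound[where B=1]) auto
  qed (simp add: dist_norm)
  finally show "(LINT z|lborel. exp (- (norm z / s)\<^sup>2 / 2) * (cmod (fourier \<mu> z))\<^sup>2)
           = (s * sqrt (2 * pi)) ^ DIM('a) * gaussian_energy s \<mu>"
    by (simp only: of_real_eq_iff g_def)
qed

section \<open>Fourier energy and Gaussian energy\<close>

lemma fourier_energy_integrable:
  fixes \<mu> :: "'a::euclidean_space measure"
  assumes mu: "finite_borel_measure \<mu>"
  shows "integrable lborel (\<lambda>z. indicator (cball 0 R) z *\<^sub>R (cmod (fourier \<mu> z))\<^sup>2)"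
proof (rule Bochner_Integration.integrable_bound)
  have [measurable]: "fourier \<mu> \<in> borel_measurable borel" "cball 0 R \<in> sets (borel :: 'a measure)"
    using measurable_fourier[OF mu] by auto
  show "integrable lborel (\<lambda>z::'a. (measure \<mu> UNIV)\<^sup>2 * indicator (cball 0 R) z)"
    by (intro integrable_mult_right integrable_real_indicator) (use emeasure_bounded_finite[OF bounded_cball] in auto)
  show "(\<lambda>z. indicator (cball 0 R) z *\<^sub>R (cmod (fourier \<mu> z))\<^sup>2) \<in> borel_measurable lborel"
    by measurable
  show "AE z in lborel. norm (indicator (cball 0 R) z *\<^sub>R (cmod (fourier \<mu> z))\<^sup>2) \<le> norm ((measure \<mu> UNIV)\<^sup>2 * indicator (cball 0 R) z)"
    using norm_fourier_le[OF mu] by (auto simp: indicator_def intro!: power_mono)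
qed

text \<open>
  On the ball of radius \<open>R\<close> the Gaussian weight of width \<open>R\<close> is at least \<open>exp (- 1 / 2)\<close>.
\<close>

lemma fourier_energy_le:
  fixes \<mu> :: "'a::euclidean_space measure"
  assumes mu: "finite_borel_measure \<mu>" and R: "R > 0"
  shows "(LINT z:cball 0 R|lborel. (cmod (fourier \<mu> z))\<^sup>2) \<le> exp (1 / 2) * (R * sqrt (2 * pi)) ^ DIM('a) * gaussian_energy R \<mu>"
proof -
  have "(LINT z:cball 0 R|lborel. (cmod (fourier \<mu> z))\<^sup>2)
      \<le> (LINT z|lborel. exp (1 / 2) * (exp (- (norm z / R)\<^sup>2 / 2) * (cmod (fourier \<mu> z))\<^sup>2))"
    unfolding set_lebesgue_integral_def
  proof (rule integral_mono)
    show "integrable lborel (\<lambda>z. exp (1 / 2) * (exp (- (norm z / R)\<^sup>2 / 2) * (cmod (fourier \<mu> z))\<^sup>2))"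
      by (intro integrable_mult_right gaussian_weighted_fourier(1) mu R)
    fix z :: 'a
    have "1 \<le> exp (1 / 2) * exp (- (norm z / R)\<^sup>2 / 2)" if "norm z \<le> R"
      using that R by (simp add: field_simps power_mono flip: exp_add)
    from mult_right_mono[OF this, of "(cmod (fourier \<mu> z))\<^sup>2"]
    show "indicator (cball 0 R) z *\<^sub>R (cmod (fourier \<mu> z))\<^sup>2 \<le> exp (1 / 2) * (exp (- (norm z / R)\<^sup>2 / 2) * (cmod (fourier \<mu> z))\<^sup>2)"
      by (auto simp: indicator_def mult.assoc)
  qed (rule fourier_energy_integrable[OF mu])
  also have "\<dots> = exp (1 / 2) * ((R * sqrt (2 * pi)) ^ DIM('a) * gaussian_energy R \<mu>)"
    by (simp only: integral_mult_right_zero gaussian_weighted_fourier(2)[OF mu R])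
  finally show ?thesis by (simp only: mult.assoc)
qed

text \<open>
  The Gaussian weight is at most 1 inside the ball. Outside it, half of the exponent is
  bounded by its value at \<open>|z| = R\<close> and the other half is kept as a wider Gaussian, integrated against the
  trivial bound on \<open>\<mu>^\<close>. The error is negligible as soon as \<open>R / s\<close> is a positive power of \<open>R\<close>.
\<close>

lemma fourier_energy_ge:
  fixes \<mu> :: "'a::euclidean_space measure"
  assumes mu: "finite_borel_measure \<mu>" and s: "s > 0" and R: "R > 0"
  shows "(s * sqrt (2 * pi)) ^ DIM('a) * (gaussian_energy s \<mu> - (measure \<mu> UNIV)\<^sup>2 * sqrt 2 ^ DIM('a) * exp (- (R / s)\<^sup>2 / 4))
    \<le> (LINT z:cball 0 R|lborel. (cmod (fourier \<mu> z))\<^sup>2)"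
proof -
  define c where "c = (measure \<mu> UNIV)\<^sup>2 * exp (- (R / s)\<^sup>2 / 4)"
  have s': "s * sqrt 2 > 0" using s by simp
  note i1 = gaussian_weighted_fourier(1)[OF mu s]
  have i2: "integrable lborel (\<lambda>z::'a. c * exp (- (norm z / (s * sqrt 2))\<^sup>2 / 2))"
    by (intro integrable_mult_right gaussian_integral(1) s')
  have "(s * sqrt (2 * pi)) ^ DIM('a) * gaussian_energy s \<mu> - c * (s * sqrt 2 * sqrt (2 * pi)) ^ DIM('a)
      = (LINT z|lborel. exp (- (norm z / s)\<^sup>2 / 2) * (cmod (fourier \<mu> z))\<^sup>2 - c * exp (- (norm z / (s * sqrt 2))\<^sup>2 / 2))"
    by (simp only: Bochner_Integration.integral_diff[OF i1 i2] integral_mult_right_zero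
        gaussian_weighted_fourier(2)[OF mu s] gaussian_integral(2)[OF s'])
  also have "\<dots> \<le> (LINT z:cball 0 R|lborel. (cmod (fourier \<mu> z))\<^sup>2)"
    unfolding set_lebesgue_integral_def
  proof (rule integral_mono)
    fix z :: 'a
    show "exp (- (norm z / s)\<^sup>2 / 2) * (cmod (fourier \<mu> z))\<^sup>2 - c * exp (- (norm z / (s * sqrt 2))\<^sup>2 / 2)
      \<le> indicator (cball 0 R) z *\<^sub>R (cmod (fourier \<mu> z))\<^sup>2"
    proof (cases "norm z \<le> R")
      case True
      have "exp (- (norm z / s)\<^sup>2 / 2) * (cmod (fourier \<mu> z))\<^sup>2 \<le> 1 * (cmod (fourier \<mu> z))\<^sup>2"
        by (rule mult_right_mono) auto
      moreover have "c * exp (- (norm z / (s * sqrt 2))\<^sup>2 / 2) \<ge> 0" by (simp add: c_def)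
      ultimately show ?thesis using True by simp
    next
      case False
      have "(R / s)\<^sup>2 \<le> (norm z / s)\<^sup>2"
        using False s R by (intro power_mono divide_right_mono) auto
      then have "exp (- (norm z / s)\<^sup>2 / 4) \<le> exp (- (R / s)\<^sup>2 / 4)" by simp
      moreover have "exp (- (norm z / s)\<^sup>2 / 2) = exp (- (norm z / s)\<^sup>2 / 4) * exp (- (norm z / s)\<^sup>2 / 4)"
        by (simp flip: exp_add)
      moreover have "exp (- (norm z / (s * sqrt 2))\<^sup>2 / 2) = exp (- (norm z / s)\<^sup>2 / 4)"
        by (simp add: power_divide power_mult_distrib)
      ultimately have "exp (- (norm z / s)\<^sup>2 / 2) \<le> exp (- (R / s)\<^sup>2 / 4) * exp (- (norm z / (s * sqrt 2))\<^sup>2 / 2)"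
        by (metis exp_ge_zero mult_right_mono)
      moreover have "(cmod (fourier \<mu> z))\<^sup>2 \<le> (measure \<mu> UNIV)\<^sup>2"
        using norm_fourier_le[OF mu] by (intro power_mono) auto
      ultimately have "exp (- (norm z / s)\<^sup>2 / 2) * (cmod (fourier \<mu> z))\<^sup>2
          \<le> (exp (- (R / s)\<^sup>2 / 4) * exp (- (norm z / (s * sqrt 2))\<^sup>2 / 2)) * (measure \<mu> UNIV)\<^sup>2"
        by (intro mult_mono) auto
      then show ?thesis using False by (simp add: c_def algebra_simps)
    qed
  qed (intro Bochner_Integration.integrable_diff i1 i2 fourier_energy_integrable mu)+
  finally show ?thesis
    by (simp add: c_def power_mult_distrib algebra_simps)
qed

lemma gaussian_energy_integrable:
  fixes \<mu> :: "'a::euclidean_space measure"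
  assumes mu: "finite_borel_measure \<mu>"
  shows "integrable \<mu> (\<lambda>y. exp (- (s * dist x y)\<^sup>2 / 2))"
    and "integrable \<mu> (\<lambda>x. LINT y|\<mu>. exp (- (s * dist x y)\<^sup>2 / 2))"
proof -
  interpret finite_measure \<mu> using finite_borel_measureD[OF mu] by simp
  have [measurable_cong]: "sets \<mu> = sets borel" and sp[simp]: "space \<mu> = UNIV"
    using finite_borel_measureD[OF mu] by simp_all
  show int: "integrable \<mu> (\<lambda>y. exp (- (s * dist x y)\<^sup>2 / 2))" for x
    by (rule integrable_const_bound[where B=1]) auto
  show "integrable \<mu> (\<lambda>x. LINT y|\<mu>. exp (- (s * dist x y)\<^sup>2 / 2))"
  proof (rule integrable_const_bound[where B="measure \<mu> UNIV"])
    have "(LINT y|\<mu>. exp (- (s * dist x y)\<^sup>2 / 2)) \<le> (LINT y|\<mu>. 1)" for x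
      by (rule integral_mono) (use int in auto)
    moreover have "(LINT y|\<mu>. exp (- (s * dist x y)\<^sup>2 / 2)) \<ge> 0" for x
      by simp
    ultimately show "AE x in \<mu>. norm (LINT y|\<mu>. exp (- (s * dist x y)\<^sup>2 / 2)) \<le> measure \<mu> UNIV"
      by simp
  qed measurable
qed

text \<open>
  Make the covering sets disjoint. Two points of the same piece contribute at least \<open>exp (- 1 / 2)\<close> to
  the energy, so the energy dominates the sum of the squared masses of the pieces, and by
  Cauchy--Schwarz this sum is smallest when the mass is shared equally.
\<close>

lemma gaussian_energy_ge_of_cover:
  fixes \<mu> :: "'a::euclidean_space measure"
  assumes mu: "finite_borel_measure \<mu>" and S: "S \<in> sets borel"
    and C: "finite \<C>" "S \<subseteq> \<Union>\<C>" "\<And>U. U \<in> \<C> \<Longrightarrow> bounded U \<and> diameter U \<le> r"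
    and s: "s > 0" "s * r \<le> 1"
  shows "(measure \<mu> S)\<^sup>2 \<le> exp (1 / 2) * card \<C> * gaussian_energy s \<mu>"
proof -
  interpret finite_measure \<mu> using finite_borel_measureD[OF mu] by simp
  have sets[measurable_cong]: "sets \<mu> = sets borel" and sp[simp]: "space \<mu> = UNIV"
    using finite_borel_measureD[OF mu] by simp_all
  note [measurable] = S
  define n where "n = card \<C>"
  obtain f where f: "bij_betw f {..<n} \<C>"
    using C(1) ex_bij_betw_nat_finite[of \<C>] by (auto simp: n_def atLeast0LessThan)
  \<comment> \<open>The closures of the covering sets are used because the sets themselves need not be Borel,
    and they have the same diameters.\<close>
  define A where "A i = closure (f i) \<inter> S" for i
  define V where "V = disjointed A"
  have A[measurable]: "A i \<in> sets borel" for i by (simp add: A_def)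
  have "range V \<subseteq> sets borel" unfolding V_def by (rule sets.range_disjointed_sets) auto
  then have V[measurable]: "V i \<in> sets borel" for i by auto
  have disj: "disjoint_family V" unfolding V_def by (rule disjoint_family_disjointed)
  have near: "s * dist x y \<le> 1" if "i < n" "x \<in> V i" "y \<in> V i" for i x y
  proof -
    have U: "bounded (f i)" "diameter (f i) \<le> r" using C(3)[of "f i"] f that(1) by (auto simp: bij_betw_def)
    have "x \<in> closure (f i)" "y \<in> closure (f i)"
      using that disjointed_subset[of A i] by (auto simp: V_def A_def)
    then have "dist x y \<le> diameter (closure (f i))"
      using U by (intro diameter_bounded_bound) auto
    then have "dist x y \<le> r" using U by (simp add: diameter_closure)
    then show ?thesis using s mult_left_mono[of "dist x y" r s] by linarith
  qed
  have US: "(\<Union>i<n. V i) = S"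
  proof -
    have "(\<Union>i<n. V i) = (\<Union>i<n. A i)"
      using UN_disjointed_eq finite_UN_disjointed_eq[of A n] by (simp add: V_def atLeast0LessThan)
    also have "\<dots> = S"
    proof
      show "S \<subseteq> (\<Union>i<n. A i)"
      proof
        fix x assume "x \<in> S"
        then obtain i where "i < n" "x \<in> f i" using C(2) f by (auto simp: bij_betw_def)
        with \<open>x \<in> S\<close> show "x \<in> (\<Union>i<n. A i)"
          using closure_subset[of "f i"] by (auto simp: A_def)
      qed
    qed (auto simp: A_def)
    finally show ?thesis .
  qed
  have mS: "measure \<mu> S = (\<Sum>i<n. measure \<mu> (V i))"
    unfolding US[symmetric]
    by (rule finite_measure_finite_Union) (use disj in \<open>auto simp: disjoint_family_on_def sets\<close>)
  have pt: "(\<Sum>i<n. indicator (V i) x * indicator (V i) y) \<le> exp (1 / 2) * exp (- (s * dist x y)\<^sup>2 / 2)" for x y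
  proof (cases "\<exists>i<n. x \<in> V i \<and> y \<in> V i")
    case True
    then obtain i where i: "i < n" "x \<in> V i" "y \<in> V i" by auto
    have "(\<Sum>j<n. indicator (V j) x * indicator (V j) y :: real) = (\<Sum>j<n. if j = i then 1 else 0)"
      using i disj by (intro sum.cong) (auto simp: indicator_def disjoint_family_on_def)
    then have "(\<Sum>j<n. indicator (V j) x * indicator (V j) y :: real) = 1"
      using i by simp
    moreover have "(s * dist x y)\<^sup>2 \<le> 1"
      using near[OF i] s by (intro power_le_one) auto
    then have "1 \<le> exp (1 / 2) * exp (- (s * dist x y)\<^sup>2 / 2)"
      by (simp flip: exp_add)
    ultimately show ?thesis by simp
  next
    case False
    then have "(\<Sum>j<n. indicator (V j) x * indicator (V j) y :: real) = 0"
      by (intro sum.neutral) (auto simp: indicator_def)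
    then show ?thesis by simp
  qed
  have iV: "integrable \<mu> (indicator (V i) :: 'a \<Rightarrow> real)" for i
    by (intro integrable_real_indicator) (auto simp: sets less_top[symmetric])
  have iV': "integrable \<mu> (\<lambda>y. \<Sum>i<n. indicator (V i) x * indicator (V i) y :: real)" for x
    by (intro Bochner_Integration.integrable_sum integrable_mult_right iV)
  have inner: "(\<Sum>i<n. indicator (V i) x * measure \<mu> (V i)) \<le> exp (1 / 2) * (LINT y|\<mu>. exp (- (s * dist x y)\<^sup>2 / 2))" for x
  proof -
    have "(\<Sum>i<n. indicator (V i) x * measure \<mu> (V i)) = (LINT y|\<mu>. (\<Sum>i<n. indicator (V i) x * indicator (V i) y))"
      using iV by (simp add: Bochner_Integration.integral_sum integrable_mult_right)
    also have "\<dots> \<le> (LINT y|\<mu>. exp (1 / 2) * exp (- (s * dist x y)\<^sup>2 / 2))"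
      by (intro integral_mono pt iV' integrable_mult_right gaussian_energy_integrable mu)
    finally show ?thesis by simp
  qed
  have "(LINT x|\<mu>. (\<Sum>i<n. indicator (V i) x * measure \<mu> (V i))) = (\<Sum>i<n. LINT x|\<mu>. indicator (V i) x * measure \<mu> (V i))"
    by (intro Bochner_Integration.integral_sum integrable_mult_left iV)
  then have "(\<Sum>i<n. (measure \<mu> (V i))\<^sup>2) = (LINT x|\<mu>. (\<Sum>i<n. indicator (V i) x * measure \<mu> (V i)))"
    by (simp add: power2_eq_square)
  also have "\<dots> \<le> (LINT x|\<mu>. exp (1 / 2) * (LINT y|\<mu>. exp (- (s * dist x y)\<^sup>2 / 2)))"
    by (intro integral_mono inner Bochner_Integration.integrable_sum integrable_mult_left iV integrable_mult_right gaussian_energy_integrable mu)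
  also have "\<dots> = exp (1 / 2) * gaussian_energy s \<mu>"
    by (simp add: gaussian_energy_def)
  finally have *: "(\<Sum>i<n. (measure \<mu> (V i))\<^sup>2) \<le> exp (1 / 2) * gaussian_energy s \<mu>" .
  have "(measure \<mu> S)\<^sup>2 \<le> (\<Sum>i<n. (measure \<mu> (V i))\<^sup>2) * n"
    unfolding mS using sum_squared_le_sum_of_squares[of "\<lambda>i. measure \<mu> (V i)" "{..<n}"] by simp
  also have "\<dots> \<le> exp (1 / 2) * gaussian_energy s \<mu> * n"
    by (intro mult_right_mono *) auto
  finally show ?thesis by (simp add: n_def mult_ac)
qed

text \<open>
  Points closer than \<open>\<rho>\<close> to \<open>x\<close> contribute at most their mass, and the others see only the tail of the Gaussian.
\<close>

lemma gaussian_energy_le_of_ball_bound: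
  fixes \<mu> :: "'a::euclidean_space measure"
  assumes mu: "finite_borel_measure \<mu>" and s: "s > 0" and \<rho>: "\<rho> > 0"
    and M: "\<And>x. measure \<mu> (cball x \<rho>) \<le> M"
  shows "gaussian_energy s \<mu> \<le> measure \<mu> UNIV * (M + measure \<mu> UNIV * exp (- (s * \<rho>)\<^sup>2 / 2))"
proof -
  interpret finite_measure \<mu> using finite_borel_measureD[OF mu] by simp
  have sets[measurable_cong]: "sets \<mu> = sets borel" and sp[simp]: "space \<mu> = UNIV"
    using finite_borel_measureD[OF mu] by simp_all
  have inner: "(LINT y|\<mu>. exp (- (s * dist x y)\<^sup>2 / 2)) \<le> M + measure \<mu> UNIV * exp (- (s * \<rho>)\<^sup>2 / 2)" for x
  proof -
    have i: "integrable \<mu> (indicator (cball x \<rho>) :: 'a \<Rightarrow> real)"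
      by (intro integrable_real_indicator) (auto simp: sets less_top[symmetric])
    have "(LINT y|\<mu>. exp (- (s * dist x y)\<^sup>2 / 2)) \<le> (LINT y|\<mu>. indicator (cball x \<rho>) y + exp (- (s * \<rho>)\<^sup>2 / 2))"
    proof (rule integral_mono)
      fix y
      show "exp (- (s * dist x y)\<^sup>2 / 2) \<le> indicator (cball x \<rho>) y + exp (- (s * \<rho>)\<^sup>2 / 2)"
      proof (cases "dist x y \<le> \<rho>")
        case True
        have "exp (- (s * dist x y)\<^sup>2 / 2) \<le> 1" by simp
        then show ?thesis using True by (simp add: add_increasing2)
      next
        case False
        then have "(s * \<rho>)\<^sup>2 \<le> (s * dist x y)\<^sup>2"
          using s \<rho> by (intro power_mono mult_left_mono) auto
        then show ?thesis using False by simp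
      qed
    qed (intro gaussian_energy_integrable mu Bochner_Integration.integrable_add i integrable_const)+
    also have "\<dots> = measure \<mu> (cball x \<rho>) + measure \<mu> UNIV * exp (- (s * \<rho>)\<^sup>2 / 2)"
      using i by simp
    finally show ?thesis using M[of x] by simp
  qed
  have "gaussian_energy s \<mu> \<le> (LINT x|\<mu>. M + measure \<mu> UNIV * exp (- (s * \<rho>)\<^sup>2 / 2))"
    unfolding gaussian_energy_def
    by (intro integral_mono gaussian_energy_integrable mu inner integrable_const)
  then show ?thesis by simp
qed

lemma emeasure_compl_spt:
  fixes \<mu> :: "'a::second_countable_topology measure"
  assumes "finite_borel_measure \<mu>"
  shows "open (- spt \<mu>)" "emeasure \<mu> (- spt \<mu>) = 0"
proof -
  have sets: "sets \<mu> = sets borel" using assms by (simp add: finite_borel_measure_def)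
  define \<U> where "\<U> = {U. open U \<and> emeasure \<mu> U = 0}"
  have eq: "- spt \<mu> = \<Union>\<U>" by (auto simp: spt_def \<U>_def)
  show "open (- spt \<mu>)" unfolding eq by (auto simp: \<U>_def)
  obtain \<V> where \<V>: "\<V> \<subseteq> \<U>" "countable \<V>" "\<Union>\<V> = \<Union>\<U>"
    using Lindelof[of \<U>] by (auto simp: \<U>_def)
  have "(\<Union>U\<in>\<V>. U) \<in> null_sets \<mu>"
    using \<V> by (intro null_sets_UN') (auto simp: \<U>_def sets null_sets_def)
  then show "emeasure \<mu> (- spt \<mu>) = 0" unfolding eq using \<V>(3) by auto
qed

lemma measure_Int_spt:
  fixes \<mu> :: "'a::second_countable_topology measure"
  assumes mu: "finite_borel_measure \<mu>" and A: "A \<in> sets borel"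
  shows "measure \<mu> (A \<inter> spt \<mu>) = measure \<mu> A"
proof -
  have sets: "sets \<mu> = sets borel" using assms by (simp add: finite_borel_measure_def)
  have "- spt \<mu> \<in> null_sets \<mu>" using emeasure_compl_spt[OF mu] by (auto simp: sets)
  then have "measure \<mu> (A - (- spt \<mu>)) = measure \<mu> A"
    using A sets by (intro measure_Diff_null_set) auto
  then show ?thesis by (simp add: Diff_eq)
qed

lemma measure_pos_of_meets_spt:
  fixes \<mu> :: "'a::second_countable_topology measure"
  assumes mu: "finite_borel_measure \<mu>" and U: "open U" "U \<inter> spt \<mu> \<noteq> {}"
  shows "measure \<mu> U > 0"
proof -
  interpret finite_measure \<mu> using mu by (simp add: finite_borel_measure_def)
  have "emeasure \<mu> U > 0" using U by (auto simp: spt_def)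
  then show ?thesis by (simp add: emeasure_eq_measure)
qed

text \<open>
  The logarithm of 0 is 0 by convention, so an exponent can be bounded from below only after this.
  As \<open>s\<close> tends to 0 the Gaussian energy stays bounded away from 0, because the support is
  bounded, while the error in \<open>fourier_energy_ge\<close> tends to 0.
\<close>

lemma fourier_energy_pos:
  fixes \<mu> :: "'a::euclidean_space measure"
  assumes mu: "finite_borel_measure \<mu>" and F: "compact (spt \<mu>)" "spt \<mu> \<noteq> {}" and R: "R > 0"
  shows "(LINT z:cball 0 R|lborel. (cmod (fourier \<mu> z))\<^sup>2) > 0"
proof -
  define m where "m = measure \<mu> UNIV"
  have m: "m > 0" unfolding m_def using measure_pos_of_meets_spt[OF mu, of UNIV] F by simp
  define c where "c = m\<^sup>2 / exp (1/2)"
  define k where "k = m\<^sup>2 * sqrt 2 ^ DIM('a)"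
  have c: "c > 0" using m by (simp add: c_def)
  have energy: "gaussian_energy s \<mu> \<ge> c" if "s > 0" "s * diameter (spt \<mu>) \<le> 1" for s
  proof -
    have "(measure \<mu> (UNIV \<inter> spt \<mu>))\<^sup>2 \<le> exp (1 / 2) * card {spt \<mu>} * gaussian_energy s \<mu>"
      by (rule gaussian_energy_ge_of_cover[OF mu _ _ _ _ that])
        (use F in \<open>auto simp: compact_imp_bounded intro: borel_closed compact_imp_closed\<close>)
    then show ?thesis
      by (subst (asm) measure_Int_spt[OF mu]) (auto simp: c_def m_def field_simps)
  qed
  have "((\<lambda>s. c - k * exp (- (R / s)\<^sup>2 / 4)) \<longlongrightarrow> c - k * 0) (at_right 0)"
  proof (intro tendsto_intros)
    show "((\<lambda>s. exp (- (R / s)\<^sup>2 / 4)) \<longlongrightarrow> 0) (at_right 0)"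
      using R by real_asymp
  qed
  then have "eventually (\<lambda>s. c - k * exp (- (R / s)\<^sup>2 / 4) > 0) (at_right 0)"
    using c by (intro order_tendstoD(1)) auto
  moreover have "((\<lambda>s. s * diameter (spt \<mu>)) \<longlongrightarrow> 0 * diameter (spt \<mu>)) (at_right 0)"
    by (intro tendsto_intros)
  then have "eventually (\<lambda>s. s * diameter (spt \<mu>) < 1) (at_right 0)"
    by (rule order_tendstoD) simp
  moreover have "eventually (\<lambda>s::real. s > 0) (at_right 0)"
    by (simp add: eventually_at_right_less)
  ultimately have "eventually (\<lambda>s. c - k * exp (- (R / s)\<^sup>2 / 4) > 0 \<and> s * diameter (spt \<mu>) < 1 \<and> s > 0) (at_right 0)"
    by eventually_elim auto
  then obtain s where s: "c - k * exp (- (R / s)\<^sup>2 / 4) > 0" "s * diameter (spt \<mu>) < 1" "s > 0"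
    using eventually_happens'[OF trivial_limit_at_right_real] by blast
  have "0 < (s * sqrt (2 * pi)) ^ DIM('a) * (gaussian_energy s \<mu> - k * exp (- (R / s)\<^sup>2 / 4))"
    using s energy[of s] by (intro mult_pos_pos zero_less_power) auto
  also have "\<dots> \<le> (LINT z:cball 0 R|lborel. (cmod (fourier \<mu> z))\<^sup>2)"
    using fourier_energy_ge[OF mu s(3) R] by (simp add: k_def m_def)
  finally show ?thesis .
qed

section \<open>Covering numbers and the upper bound for the decay\<close>

lemma covering_number_le_card:
  assumes "finite \<C>" "\<And>U. U \<in> \<C> \<Longrightarrow> bounded U \<and> diameter U = r" "A \<subseteq> \<Union>\<C>"
  shows "covering_number r A \<le> card \<C>"
  unfolding covering_number_def using assms by (intro Least_le) blast

lemma covering_number_attained: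
  fixes A :: "'a::euclidean_space set"
  assumes "compact A" "r > 0"
  obtains \<C> where "finite \<C>" "card \<C> = covering_number r A" "\<And>U. U \<in> \<C> \<Longrightarrow> bounded U \<and> diameter U = r" "A \<subseteq> \<Union>\<C>"
proof -
  have "r / 2 > 0" using assms by simp
  then obtain k where k: "finite k" "A \<subseteq> (\<Union>x\<in>k. ball x (r / 2))"
    using assms(1) unfolding compact_eq_totally_bounded by blast
  have "finite ((\<lambda>x. cball x (r / 2)) ` k)" using k(1) by simp
  moreover have "A \<subseteq> \<Union>((\<lambda>x. cball x (r / 2)) ` k)"
    using k(2) by (rule order_trans) (intro UN_mono ball_subset_cball order_refl)
  moreover have "\<forall>U\<in>(\<lambda>x. cball x (r / 2)) ` k. bounded U \<and> diameter U = r"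
    using assms(2) by auto
  ultimately have "\<exists>n \<C>. finite \<C> \<and> card \<C> = n \<and> (\<forall>U\<in>\<C>. bounded U \<and> diameter U = r) \<and> A \<subseteq> \<Union>\<C>"
    by blast
  from LeastI_ex[OF this] show ?thesis
    using that unfolding covering_number_def by blast
qed

lemma covering_number_pos:
  fixes A :: "'a::euclidean_space set"
  assumes "compact A" "A \<noteq> {}" "r > 0"
  shows "covering_number r A > 0"
proof -
  obtain \<C> where \<C>: "finite \<C>" "card \<C> = covering_number r A" "A \<subseteq> \<Union>\<C>"
    by (rule covering_number_attained[OF assms(1,3)])
  then have "\<C> \<noteq> {}" using assms(2) by auto
  then show ?thesis using \<C> by (metis card_gt_0_iff)
qed

lemma lower_box_dim_nonneg:
  fixes A :: "'a::euclidean_space set"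
  assumes "compact A" "A \<noteq> {}"
  shows "lower_box_dim A \<ge> 0"
  unfolding lower_box_dim_def
proof (rule Liminf_bounded)
  have "eventually (\<lambda>r::real. r \<in> {0<..<1}) (at_right 0)"
    by (rule eventually_at_right_real) simp
  then show "eventually (\<lambda>r. 0 \<le> ereal (ln (real (covering_number r A)) / - ln r)) (at_right 0)"
  proof eventually_elim
    case (elim r)
    then have "ln (real (covering_number r A)) \<ge> 0"
      using covering_number_pos[OF assms, of r] by (intro ln_ge_zero) auto
    then show ?case using elim by (auto simp: divide_nonneg_neg)
  qed
qed

text \<open>
  A lower limit below \<open>t\<close> means that arbitrarily small scales with few covering sets exist; picking them one after the
  other makes them monotone, as the sequence \<open>R\<close> has to be.
\<close>

lemma scales_of_lower_box_dim_less:
  fixes A :: "'a::euclidean_space set"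
  assumes "lower_box_dim A < ereal t"
  obtains r :: "nat \<Rightarrow> real" where "\<And>n. 0 < r n" "decseq r" "r \<longlonglongrightarrow> 0"
    "\<And>n. real (covering_number (r n) A) \<le> r n powr - t"
proof -
  define P where "P r \<longleftrightarrow> real (covering_number r A) \<le> r powr - t" for r
  have ex: "\<exists>r. 0 < r \<and> r < \<delta> \<and> P r" if "\<delta> > 0" for \<delta>
  proof (rule ccontr)
    assume *: "\<not> ?thesis"
    have "eventually (\<lambda>r::real. r \<in> {0<..<min 1 \<delta>}) (at_right 0)"
      by (rule eventually_at_right_real) (use that in simp)
    then have "eventually (\<lambda>r. ereal t \<le> ereal (ln (real (covering_number r A)) / (- ln r))) (at_right 0)"
    proof eventually_elim
      case (elim r)
      then have N: "r powr - t < real (covering_number r A)" using * by (auto simp: P_def)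
      then have "ln (r powr - t) \<le> ln (real (covering_number r A))"
        using elim by (intro ln_mono) auto
      then have "- t * ln r \<le> ln (real (covering_number r A))" using elim by (simp add: ln_powr)
      then show ?case using elim by (simp add: field_simps)
    qed
    then have "ereal t \<le> lower_box_dim A" unfolding lower_box_dim_def by (rule Liminf_bounded)
    then show False using assms by simp
  qed
  have "\<exists>r. \<forall>n. (0 < r n \<and> r n < inverse (real (Suc n)) \<and> P (r n)) \<and> r (Suc n) \<le> r n"
  proof (rule dependent_nat_choice)
    show "\<exists>r. 0 < r \<and> r < inverse (real (Suc 0)) \<and> P r" using ex[of 1] by auto
    fix x n assume x: "0 < x \<and> x < inverse (real (Suc n)) \<and> P x"
    obtain y where "0 < y" "y < min x (inverse (real (Suc (Suc n))))" "P y"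
      using ex[of "min x (inverse (real (Suc (Suc n))))"] x by auto
    then show "\<exists>y. (0 < y \<and> y < inverse (real (Suc (Suc n))) \<and> P y) \<and> y \<le> x" by (intro exI[of _ y]) auto
  qed
  then obtain r where r: "\<And>n. 0 < r n" "\<And>n. r n < inverse (real (Suc n))" "\<And>n. P (r n)" "\<And>n. r (Suc n) \<le> r n"
    by blast
  show thesis
  proof
    show "r \<longlonglongrightarrow> 0"
    proof (rule tendsto_sandwich[OF _ _ tendsto_const LIMSEQ_inverse_real_of_nat])
      show "eventually (\<lambda>n. 0 \<le> r n) sequentially" "eventually (\<lambda>n. r n \<le> inverse (real (Suc n))) sequentially"
        using r(1,2) by (auto intro!: always_eventually less_imp_le)
    qed
    show "decseq r" by (rule decseq_SucI) (rule r(4))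
  qed (use r in \<open>auto simp: P_def\<close>)
qed

lemma eventually_covering_number_ge:
  fixes A :: "'a::euclidean_space set"
  assumes A: "compact A" "A \<noteq> {}" and "ereal t < lower_box_dim A"
  shows "eventually (\<lambda>r. r powr - t \<le> real (covering_number r A)) (at_right 0)"
proof -
  have "eventually (\<lambda>r. ereal t < ereal (ln (real (covering_number r A)) / (- ln r))) (at_right 0)"
    using assms(3) unfolding lower_box_dim_def by (rule less_LiminfD)
  moreover have "eventually (\<lambda>r::real. r \<in> {0<..<1}) (at_right 0)"
    by (rule eventually_at_right_real) simp
  ultimately show ?thesis
  proof eventually_elim
    case (elim r)
    then have "covering_number r A > 0" by (intro covering_number_pos A) auto
    moreover have "- t * ln r < ln (real (covering_number r A))" using elim by (simp add: field_simps)
    then have "exp (- t * ln r) \<le> exp (ln (real (covering_number r A)))" by simp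
    ultimately show ?case using elim by (simp add: powr_def)
  qed
qed

definition fourier_decay_exponent :: "real \<Rightarrow> 'a::euclidean_space measure \<Rightarrow> real" where
  "fourier_decay_exponent R \<mu> =
     ln (R powi (- int DIM('a)) * (LINT z:cball 0 R|lborel. (cmod (fourier \<mu> z))\<^sup>2)) / (- ln R)"

lemma ln_div_neg_ln_le:
  fixes R x t :: real
  assumes "R > 1" "R powr - t \<le> x"
  shows "ln x / (- ln R) \<le> t"
proof -
  have "ln (R powr - t) \<le> ln x" using assms by (intro ln_mono) auto
  then have "- t * ln R \<le> ln x" using assms by (simp add: ln_powr)
  then show ?thesis using assms by (simp add: field_simps)
qed

lemma ln_div_neg_ln_ge:
  fixes R x t :: real
  assumes "R > 1" "0 < x" "x \<le> R powr - t"
  shows "t \<le> ln x / (- ln R)"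
proof -
  have "ln x \<le> ln (R powr - t)" using assms by (intro ln_mono) auto
  then have "ln x \<le> - t * ln R" using assms by (simp add: ln_powr)
  then show ?thesis using assms by (simp add: field_simps)
qed

text \<open>
  The bound from \<open>fourier_energy_ge\<close> at frequency \<open>R = s\<^bsup>1+\<epsilon>\<^esup>\<close>, when the energy is at least \<open>A s\<^bsup>-t\<^esup>\<close>. The
  main term is of order \<open>s\<^bsup>-\<epsilon> D - t\<^esup>\<close>, so the condition on \<open>\<epsilon>\<close> says exactly that it beats
  \<open>R\<^bsup>-t'\<^esup>\<close>; the error is smaller than every power of \<open>s\<close>.
\<close>

lemma eventually_lower_energy_asymptotics:
  fixes A B \<epsilon> t t' :: real
  assumes "A > 0" "\<epsilon> > 0" "\<epsilon> * D + t < (1 + \<epsilon>) * t'"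
  shows "eventually (\<lambda>s::real. (s powr (1 + \<epsilon>)) powr - t' \<le>
     (s powr (1 + \<epsilon>)) powi (- int D) * ((s * sqrt (2 * pi)) ^ D * (A * s powr - t - B * exp (- (s powr (1 + \<epsilon>) / s)\<^sup>2 / 4)))) at_top"
proof -
  define \<delta> where "\<delta> = (1 + \<epsilon>) * t' - (\<epsilon> * D + t)"
  have \<delta>: "\<delta> > 0" using assms by (simp add: \<delta>_def)
  have "((\<lambda>s::real. s powr t * exp (- (s powr \<epsilon>)\<^sup>2 / 4)) \<longlongrightarrow> 0) at_top"
    using assms(2) by real_asymp
  then have "((\<lambda>s::real. B * (s powr t * exp (- (s powr \<epsilon>)\<^sup>2 / 4))) \<longlongrightarrow> B * 0) at_top"
    by (rule tendsto_mult_left)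
  then have "eventually (\<lambda>s::real. B * (s powr t * exp (- (s powr \<epsilon>)\<^sup>2 / 4)) < A / 2) at_top"
    using assms(1) by (intro order_tendstoD(2)) auto
  moreover have "filterlim (\<lambda>s::real. s powr \<delta>) at_top at_top"
    using \<delta> by real_asymp
  then have "eventually (\<lambda>s::real. s powr \<delta> \<ge> 2 / (A * sqrt (2 * pi) ^ D)) at_top"
    by (simp add: filterlim_at_top)
  moreover have "eventually (\<lambda>s::real. s > 0) at_top" by (rule eventually_gt_at_top)
  ultimately show ?thesis
  proof eventually_elim
    case (elim s)
    have q: "s powr (1 + \<epsilon>) / s = s powr \<epsilon>" using elim by (simp add: powr_add)
    have d: "(s powr (1 + \<epsilon>)) powi (- int D) * s ^ D = s powr (- (\<epsilon> * D))"
    proof -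
      have "(s powr (1 + \<epsilon>)) powi (- int D) = s powr (- ((1 + \<epsilon>) * D))"
        using elim by (simp add: power_int_minus powr_minus powr_powr powr_realpow[symmetric] mult.commute)
      then have "(s powr (1 + \<epsilon>)) powi (- int D) * s ^ D = s powr (- ((1 + \<epsilon>) * D)) * s powr D"
        using elim by (simp add: powr_realpow)
      also have "\<dots> = s powr (- (\<epsilon> * D))" by (simp add: powr_add[symmetric] algebra_simps)
      finally show ?thesis .
    qed
    have "A / 2 * s powr - t \<le> (A - B * (s powr t * exp (- (s powr \<epsilon>)\<^sup>2 / 4))) * s powr - t"
      using elim by (intro mult_right_mono) auto
    also have "\<dots> = A * s powr - t - B * exp (- (s powr \<epsilon>)\<^sup>2 / 4)"
      using elim by (simp add: algebra_simps powr_minus)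
    finally have a: "A / 2 * s powr - t \<le> A * s powr - t - B * exp (- (s powr \<epsilon>)\<^sup>2 / 4)" .
    have "(s powr (1 + \<epsilon>)) powr - t' = s powr - \<delta> * s powr (- (\<epsilon> * D)) * s powr - t"
      by (simp add: powr_powr powr_add[symmetric] \<delta>_def algebra_simps)
    also have "\<dots> \<le> (A * sqrt (2 * pi) ^ D / 2) * s powr (- (\<epsilon> * D)) * s powr - t"
    proof (intro mult_right_mono)
      show "s powr - \<delta> \<le> A * sqrt (2 * pi) ^ D / 2"
        using elim assms(1) by (simp add: powr_minus field_simps)
    qed auto
    also have "\<dots> = s powr (- (\<epsilon> * D)) * sqrt (2 * pi) ^ D * (A / 2 * s powr - t)" by simp
    also have "\<dots> \<le> s powr (- (\<epsilon> * D)) * sqrt (2 * pi) ^ D * (A * s powr - t - B * exp (- (s powr \<epsilon>)\<^sup>2 / 4))"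
      by (intro mult_left_mono a) auto
    also have "\<dots> = (s powr (1 + \<epsilon>)) powi (- int D) * ((s * sqrt (2 * pi)) ^ D * (A * s powr - t - B * exp (- (s powr (1 + \<epsilon>) / s)\<^sup>2 / 4)))"
      unfolding q d[symmetric] power_mult_distrib by (simp add: mult_ac)
    finally show ?case .
  qed
qed

text \<open>
  The frequencies are read off from scales at which \<open>K\<close> has few covering sets. They depend on \<open>K\<close> only,
  which is why one sequence serves all measures with support \<open>F\<close>.
\<close>

lemma limsup_fourier_decay_le:
  fixes F K U :: "'a::euclidean_space set"
  assumes K: "compact K" "lower_box_dim K < ereal t" and t: "0 \<le> t" "t < t'"
    and U: "open U" "U \<inter> F \<noteq> {}" "U \<inter> F \<subseteq> K"
  obtains R where "\<forall>k. 0 < R k" "incseq R" "filterlim R at_top sequentially"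
    "\<forall>\<mu> :: 'a measure. finite_borel_measure \<mu> \<longrightarrow> spt \<mu> = F \<longrightarrow> limsup (\<lambda>k. ereal (fourier_decay_exponent (R k) \<mu>)) \<le> ereal t'"
proof -
  obtain r :: "nat \<Rightarrow> real" where r: "\<And>n. 0 < r n" "decseq r" "r \<longlonglongrightarrow> 0"
    "\<And>n. real (covering_number (r n) K) \<le> r n powr - t"
    using scales_of_lower_box_dim_less[OF K(2)] by metis
  \<comment> \<open>Half of the room between \<open>t\<close> and \<open>t'\<close> is spent on the loss \<open>\<epsilon> D\<close> in the exponent.\<close>
  define \<epsilon> where "\<epsilon> = (t' - t) / (2 * DIM('a))"
  have \<epsilon>: "\<epsilon> > 0" using t by (simp add: \<epsilon>_def)
  have "\<epsilon> * DIM('a) = (t' - t) / 2" by (simp add: \<epsilon>_def)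
  moreover have "\<epsilon> * t' \<ge> 0" using \<epsilon> t by simp
  ultimately have \<epsilon>': "\<epsilon> * DIM('a) + t < (1 + \<epsilon>) * t'" using t by (simp add: algebra_simps)
  define s where "s n = inverse (r n)" for n
  define R where "R n = s n powr (1 + \<epsilon>)" for n
  have s: "s n > 0" for n using r(1) by (simp add: s_def)
  have slim: "filterlim s at_top sequentially"
    unfolding s_def using r(1,3) by (intro filterlim_inverse_at_top) (auto intro: always_eventually)
  have smono: "incseq s" using r(1,2) by (auto simp: s_def incseq_def decseq_def le_imp_inverse_le)
  have Rlim: "filterlim R at_top sequentially"
    unfolding R_def using \<epsilon> by (intro filterlim_compose[OF _ slim]) real_asymp
  show thesis
  proof
    show "\<forall>k. 0 < R k" using s by (simp add: R_def less_imp_neq[symmetric])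
    show "incseq R" using smono \<epsilon> less_imp_le[OF s] by (auto simp: R_def incseq_def intro!: powr_mono2)
    show "filterlim R at_top sequentially" by (rule Rlim)
    show "\<forall>\<mu> :: 'a measure. finite_borel_measure \<mu> \<longrightarrow> spt \<mu> = F \<longrightarrow> limsup (\<lambda>k. ereal (fourier_decay_exponent (R k) \<mu>)) \<le> ereal t'"
    proof (intro allI impI)
      fix \<mu> :: "'a measure" assume mu: "finite_borel_measure \<mu>" and F: "spt \<mu> = F"
      define a where "a = measure \<mu> (U \<inter> F)"
      have "a = measure \<mu> U" using measure_Int_spt[OF mu, of U] U(1) F by (simp add: a_def)
      then have a: "a > 0" using measure_pos_of_meets_spt[OF mu U(1)] U(2) F by simp
      define A where "A = a\<^sup>2 / exp (1 / 2)"
      define B where "B = (measure \<mu> UNIV)\<^sup>2 * sqrt 2 ^ DIM('a)"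
      have A: "A > 0" using a by (simp add: A_def)
      have borel: "U \<inter> F \<in> sets borel"
        using U(1) emeasure_compl_spt(1)[OF mu] F by (auto intro!: sets.Int borel_closed simp: closed_def)
      have energy: "A * s n powr - t \<le> gaussian_energy (s n) \<mu>" for n
      proof -
        obtain \<C> where \<C>: "finite \<C>" "card \<C> = covering_number (r n) K"
          "\<And>V. V \<in> \<C> \<Longrightarrow> bounded V \<and> diameter V = r n" "K \<subseteq> \<Union>\<C>"
          using covering_number_attained[OF K(1) r(1)] by metis
        have g: "gaussian_energy (s n) \<mu> \<ge> 0" by (simp add: gaussian_energy_def)
        have sr: "s n * r n \<le> 1" using less_imp_neq[OF r(1)[of n]] by (simp add: s_def)
        have N: "real (card \<C>) \<le> s n powr t"
          using r(4)[of n] less_imp_le[OF r(1)[of n]] \<C>(2) by (simp add: s_def powr_minus inverse_powr)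
        have "a\<^sup>2 \<le> exp (1 / 2) * card \<C> * gaussian_energy (s n) \<mu>"
          unfolding a_def
          using \<C>(3) by (intro gaussian_energy_ge_of_cover[OF mu borel \<C>(1) order_trans[OF U(3) \<C>(4)] _ s sr]) auto
        also have "\<dots> \<le> exp (1 / 2) * (s n powr t) * gaussian_energy (s n) \<mu>"
          using N g by (intro mult_right_mono mult_left_mono) auto
        finally have "A \<le> s n powr t * gaussian_energy (s n) \<mu>" by (simp add: A_def field_simps)
        then show ?thesis using s[of n] by (simp add: powr_minus field_simps)
      qed
      have "eventually (\<lambda>n. R n powr - t' \<le> R n powi (- int DIM('a)) * ((s n * sqrt (2 * pi)) ^ DIM('a) * (A * s n powr - t - B * exp (- (R n / s n)\<^sup>2 / 4)))) sequentially"
        unfolding R_def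
        by (rule eventually_compose_filterlim[OF eventually_lower_energy_asymptotics[OF A \<epsilon> \<epsilon>'] slim])
      moreover have "eventually (\<lambda>n. R n > 1) sequentially"
        using Rlim by (simp add: filterlim_at_top_dense)
      ultimately have "eventually (\<lambda>n. ereal (fourier_decay_exponent (R n) \<mu>) \<le> ereal t') sequentially"
      proof eventually_elim
        case (elim n)
        have "(s n * sqrt (2 * pi)) ^ DIM('a) * (A * s n powr - t - B * exp (- (R n / s n)\<^sup>2 / 4))
          \<le> (s n * sqrt (2 * pi)) ^ DIM('a) * (gaussian_energy (s n) \<mu> - B * exp (- (R n / s n)\<^sup>2 / 4))"
          using energy[of n] s[of n] by (intro mult_left_mono) auto
        also have "\<dots> \<le> (LINT z:cball 0 (R n)|lborel. (cmod (fourier \<mu> z))\<^sup>2)"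
          using fourier_energy_ge[OF mu s[of n], of "R n"] elim by (simp add: B_def)
        finally have "R n powr - t' \<le> R n powi (- int DIM('a)) * (LINT z:cball 0 (R n)|lborel. (cmod (fourier \<mu> z))\<^sup>2)"
          using elim by (elim order_trans) (intro mult_left_mono, auto)
        from ln_div_neg_ln_le[OF elim(2) this]
        show ?case unfolding fourier_decay_exponent_def by (simp only: ereal_less_eq)
      qed
      then show "limsup (\<lambda>k. ereal (fourier_decay_exponent (R k) \<mu>)) \<le> ereal t'"
        by (rule Limsup_bounded)
    qed
  qed
qed

lemma Baire_countable_closed_cover:
  fixes F :: "'a::euclidean_space set"
  assumes "closed F" "F \<noteq> {}" "\<And>i::nat. closed (K i)" "F \<subseteq> (\<Union>i. K i)"
  obtains i U where "open U" "U \<inter> F \<noteq> {}" "U \<inter> F \<subseteq> K i"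
proof -
  have "\<exists>i. \<not> F \<subseteq> closure (F - K i)"
  proof (rule ccontr)
    assume dense: "\<not> ?thesis"
    have "F \<subseteq> closure (\<Inter>i. F - K i)"
    proof (rule Baire)
      fix T assume "T \<in> range (\<lambda>i. F - K i)"
      then obtain i where T: "T = F - K i" by blast
      have "openin (top_of_set F) (F \<inter> - K i)"
        using assms(3)[of i] by (intro openin_open_Int) auto
      then show "openin (top_of_set F) T \<and> F \<subseteq> closure T"
        using dense unfolding T Diff_eq by blast
    qed (use assms(1) in auto)
    moreover have empty: "(\<Inter>i. F - K i) = {}" using assms(4) by blast
    ultimately show False using assms(2) unfolding empty by simp
  qed
  then obtain i x where "x \<in> F" "x \<notin> closure (F - K i)" by blast
  then show thesis
    using closure_subset[of "F - K i"] by (intro that[of "- closure (F - K i)" i]) auto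
qed

section \<open>Spreading out simple functions\<close>

text \<open>
  The closed balls of radius \<open>r / 2\<close> about a maximal separated set are sets of diameter exactly \<open>r\<close>
  and cover, and a finite union of closed balls covers the closure as well.
\<close>

lemma separated_subset_of_covering_number:
  fixes V :: "'a::euclidean_space set"
  assumes r: "r > 0" and m: "m \<le> covering_number r (closure V)"
  shows "\<exists>P\<subseteq>V. finite P \<and> m \<le> card P \<and> pairwise (\<lambda>x y. r / 2 < dist x y) P"
proof (rule ccontr)
  assume no: "\<not> ?thesis"
  define Sep where "Sep P \<longleftrightarrow> P \<subseteq> V \<and> finite P \<and> pairwise (\<lambda>x y. r / 2 < dist x y) P" for P
  have "Sep {}" by (simp add: Sep_def)
  moreover have "\<forall>P. Sep P \<longrightarrow> card P < m" using no by (auto simp: Sep_def not_le)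
  ultimately obtain P where P: "Sep P" "\<And>Q. Sep Q \<Longrightarrow> card Q \<le> card P"
    using ex_has_greatest_nat[of Sep "{}" card m] by blast
  have fin: "finite P" using P(1) by (simp add: Sep_def)
  have cov: "V \<subseteq> (\<Union>p\<in>P. cball p (r / 2))"
  proof (rule ccontr)
    assume "\<not> ?thesis"
    then obtain x where x: "x \<in> V" "\<And>p. p \<in> P \<Longrightarrow> r / 2 < dist p x" by force
    then have "x \<notin> P" using r by force
    have "Sep (insert x P)" using P(1) x by (auto simp: Sep_def pairwise_insert dist_commute)
    from P(2)[OF this] show False using \<open>x \<notin> P\<close> fin by simp
  qed
  have "closure V \<subseteq> \<Union>((\<lambda>p. cball p (r / 2)) ` P)"
    using cov fin by (intro closure_minimal closed_UN) auto
  then have "covering_number r (closure V) \<le> card ((\<lambda>p. cball p (r / 2)) ` P)"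
    using fin r by (intro covering_number_le_card) auto
  also have "\<dots> \<le> card P" using fin by (rule card_image_le)
  finally have "m \<le> card P" using m by simp
  then show False using no P(1) by (auto simp: Sep_def)
qed

text \<open>
  This is what the construction needs to know of \<open>F\<close>: at every small scale, each relatively open piece holds
  as many separated points as a set of lower box dimension above \<open>s\<close> must.
\<close>

definition locally_spread :: "real \<Rightarrow> 'a::euclidean_space set \<Rightarrow> bool" where
  "locally_spread s F \<longleftrightarrow> (\<forall>U. open U \<longrightarrow> U \<inter> F \<noteq> {} \<longrightarrow>
     (\<forall>\<^sub>F r in at_right 0. \<exists>P\<subseteq>U \<inter> F. finite P \<and> r powr - s \<le> real (card P) \<and> pairwise (\<lambda>x y. r < dist x y) P))"

text \<open>
  Separation \<open>r\<close> comes from coverings at scale \<open>2 r\<close>; the lost factor is absorbed by passing from \<open>s\<close> to \<open>s'\<close>.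
\<close>

lemma locally_spread_of_lower_box_dim:
  fixes F :: "'a::euclidean_space set"
  assumes F: "compact F" and s: "s' < s"
    and dim: "\<And>U. open U \<Longrightarrow> U \<inter> F \<noteq> {} \<Longrightarrow> ereal s < lower_box_dim (closure (U \<inter> F))"
  shows "locally_spread s' F"
  unfolding locally_spread_def
proof (intro allI impI)
  fix U :: "'a set" assume U: "open U" "U \<inter> F \<noteq> {}"
  let ?A = "closure (U \<inter> F)"
  have A: "compact ?A" "?A \<noteq> {}"
    using F U(2) by (auto simp: compact_closure intro: bounded_subset compact_imp_bounded)
  have "filterlim (\<lambda>r::real. 2 * r) (at_right 0) (at_right 0)" by real_asymp
  from eventually_compose_filterlim[OF eventually_covering_number_ge[OF A dim[OF U]] this]
  have "\<forall>\<^sub>F r in at_right 0. (2 * r) powr - s \<le> real (covering_number (2 * r) ?A)" .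
  moreover have "((\<lambda>r::real. r powr (s - s')) \<longlongrightarrow> 0) (at_right 0)"
    using s by real_asymp
  then have "\<forall>\<^sub>F r::real in at_right 0. r powr (s - s') < 2 powr - s"
    by (rule order_tendstoD) simp
  moreover have "\<forall>\<^sub>F r::real in at_right 0. r > 0"
    by (simp add: eventually_at_right_less)
  ultimately show "\<forall>\<^sub>F r in at_right 0. \<exists>P\<subseteq>U \<inter> F. finite P \<and> r powr - s' \<le> real (card P) \<and> pairwise (\<lambda>x y. r < dist x y) P"
  proof eventually_elim
    case (elim r)
    have "r powr - s' = r powr (s - s') * r powr - s" by (simp flip: powr_add)
    also have "\<dots> \<le> 2 powr - s * r powr - s" using elim by (intro mult_right_mono) auto
    also have "\<dots> = (2 * r) powr - s" using elim by (simp add: powr_mult)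
    finally have *: "r powr - s' \<le> real (covering_number (2 * r) ?A)" using elim by simp
    obtain P where P: "P \<subseteq> U \<inter> F" "finite P" "covering_number (2 * r) ?A \<le> card P" "pairwise (\<lambda>x y. r < dist x y) P"
      using separated_subset_of_covering_number[of "2 * r" "covering_number (2 * r) ?A" "U \<inter> F"] elim by auto
    then have "r powr - s' \<le> real (card P)" using * by linarith
    with P show ?case by blast
  qed
qed

text \<open>
  Each value \<open>p\<close> of \<open>g\<close> is split into \<open>m \<ge> r\<^bsup>-s\<^esup>\<close> separated values near \<open>p\<close>, the choice among them being
  made by the position of the argument among \<open>m\<close> equal subintervals of \<open>[0,1)\<close>. A ball of
  radius \<open>r / 2\<close> contains at most one of the new values coming from \<open>p\<close>, and this value is taken on a set of
  measure at most \<open>1 / m\<close>. The level sets of \<open>g\<close> need not be divided evenly, since the number of values of \<open>g\<close>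
  is fixed before \<open>r\<close> tends to 0.
\<close>

lemma refine_simple_function:
  fixes F U :: "'a::euclidean_space set" and g :: "real \<Rightarrow> 'a"
  assumes spread: "locally_spread s F" and U: "open U" and \<epsilon>: "\<epsilon> > 0"
    and g: "g \<in> borel_measurable borel" "finite (range g)" "range g \<subseteq> U \<inter> F"
  shows "\<forall>\<^sub>F r in at_right 0. \<exists>h. h \<in> borel_measurable borel \<and> finite (range h) \<and> range h \<subseteq> U \<inter> F \<and>
    (\<forall>v. dist (h v) (g v) < \<epsilon>) \<and>
    (\<forall>x. measure lborel {v\<in>{0..<1}. dist x (h v) \<le> r / 2} \<le> card (range g) * r powr s)"
proof -
  let ?good = "\<lambda>r p P. P \<subseteq> (U \<inter> ball p \<epsilon>) \<inter> F \<and> finite P \<and> r powr - s \<le> real (card P) \<and> pairwise (\<lambda>x y. r < dist x y) P"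
  have "\<forall>\<^sub>F r in at_right 0. \<exists>P. ?good r p P" if "p \<in> range g" for p
  proof -
    have "p \<in> (U \<inter> ball p \<epsilon>) \<inter> F" using that g(3) \<epsilon> by auto
    then have "open (U \<inter> ball p \<epsilon>)" "(U \<inter> ball p \<epsilon>) \<inter> F \<noteq> {}" using U by auto
    with spread show ?thesis unfolding locally_spread_def by meson
  qed
  then have "\<forall>\<^sub>F r in at_right 0. \<forall>p\<in>range g. \<exists>P. ?good r p P"
    using g(2) by (intro eventually_ball_finite) auto
  moreover have "\<forall>\<^sub>F r::real in at_right 0. r > 0"
    by (simp add: eventually_at_right_less)
  ultimately show ?thesis
  proof eventually_elim
    case (elim r)
    from bchoice[OF elim(1)] obtain P where P: "\<And>p. p \<in> range g \<Longrightarrow> ?good r p (P p)" by blast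
    define m where "m = nat \<lceil>r powr - s\<rceil>"
    have m: "m > 0" using elim by (simp add: m_def)
    have mr: "1 / real m \<le> r powr s"
    proof -
      have "r powr - s \<le> real m" unfolding m_def by linarith
      then have "1 \<le> r powr s * real m" using elim by (simp add: powr_minus field_simps)
      then show ?thesis using m by (simp add: field_simps)
    qed
    have "\<exists>e. inj_on e {..<m} \<and> e ` {..<m} \<subseteq> P p" if p: "p \<in> range g" for p
    proof -
      have "m \<le> card (P p)" using P[OF p] unfolding m_def by linarith
      moreover obtain e where e: "bij_betw e {..<card (P p)} (P p)"
        using P[OF p] ex_bij_betw_nat_finite[of "P p"] by (auto simp: atLeast0LessThan)
      ultimately have "inj_on e {..<m}" "e ` {..<m} \<subseteq> P p"
        by (auto simp: bij_betw_def intro: inj_on_subset)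
      then show ?thesis by blast
    qed
    then obtain e where e: "\<And>p. p \<in> range g \<Longrightarrow> inj_on (e p) {..<m}" "\<And>p. p \<in> range g \<Longrightarrow> e p ` {..<m} \<subseteq> P p"
      by metis
    \<comment> \<open>The remainder modulo \<open>m\<close> changes nothing on \<open>[0,1)\<close>; it keeps the index in range elsewhere.\<close>
    define idx where "idx v = nat \<lfloor>real m * v\<rfloor> mod m" for v :: real
    have idx: "idx v < m" for v using m by (simp add: idx_def)
    have [measurable]: "idx \<in> borel \<rightarrow>\<^sub>M count_space UNIV" unfolding idx_def by measurable
    define h where "h v = e (g v) (idx v)" for v
    have hP: "h v \<in> P (g v)" for v using e(2)[of "g v"] idx[of v] by (auto simp: h_def)
    have gm: "g \<in> borel \<rightarrow>\<^sub>M count_space (range g)"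
      using g(1,2) by (subst measurable_count_space_eq2) (auto intro: measurable_sets_borel)
    have hm[measurable]: "h \<in> borel_measurable borel"
      unfolding h_def[abs_def]
      by (rule measurable_compose_countable'[OF _ gm]) (use g(2) in \<open>auto intro: countable_finite\<close>)
    have "range h \<subseteq> (\<Union>p\<in>range g. P p)" using hP by blast
    then have fin: "finite (range h)" using P g(2) by (meson finite_UN finite_subset)
    have bound: "measure lborel {v\<in>{0..<1}. dist x (h v) \<le> r / 2} \<le> card (range g) * r powr s" for x
    proof -
      have "\<exists>J. J \<in> sets lborel \<and> emeasure lborel J \<noteq> \<infinity> \<and> measure lborel J \<le> 1 / m \<and> {v\<in>{0..<1}. g v = p \<and> dist x (h v) \<le> r / 2} \<subseteq> J"
        if p: "p \<in> range g" for p
      proof (cases "\<exists>i<m. dist x (e p i) \<le> r / 2")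
        case False
        then show ?thesis using idx by (intro exI[of _ "{}"]) (auto simp: h_def)
      next
        case True
        then obtain i where i: "i < m" "dist x (e p i) \<le> r / 2" by blast
        have uniq: "j = i" if j: "j < m" "dist x (e p j) \<le> r / 2" for j
        proof (rule ccontr)
          assume "j \<noteq> i"
          then have "e p j \<noteq> e p i" using e(1)[OF p] i j by (auto dest: inj_onD)
          moreover have "e p j \<in> P p" "e p i \<in> P p" using e(2)[OF p] i j by auto
          ultimately have "r < dist (e p j) (e p i)" using P[OF p] by (auto simp: pairwise_def)
          moreover have "dist (e p j) (e p i) \<le> dist x (e p j) + dist x (e p i)" by (rule dist_triangle3)
          ultimately show False using i j by linarith
        qed
        have "v \<in> {real i / m..real (Suc i) / m}" if v: "v \<in> {0..<1}" "g v = p" "dist x (h v) \<le> r / 2" for v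
        proof -
          have "idx v = i" using uniq[of "idx v"] idx[of v] v by (simp add: h_def)
          moreover have "real m * v < real m" using v m by simp
          then have "nat \<lfloor>real m * v\<rfloor> < m" using m by linarith
          ultimately have "nat \<lfloor>real m * v\<rfloor> = i" by (simp add: idx_def)
          moreover have "0 \<le> real m * v" using v by simp
          ultimately have "real i \<le> real m * v" "real m * v \<le> real (Suc i)" by linarith+
          then show ?thesis using m by (simp add: field_simps)
        qed
        moreover have "real (Suc i) / m - real i / m = 1 / m" by (simp flip: diff_divide_distrib)
        ultimately show ?thesis
          using m by (intro exI[of _ "{real i / m..real (Suc i) / m}"]) (auto simp: divide_right_mono)
      qed
      then have "\<forall>p\<in>range g. \<exists>J. J \<in> sets lborel \<and> emeasure lborel J \<noteq> \<infinity> \<and> measure lborel J \<le> 1 / m \<and> {v\<in>{0..<1}. g v = p \<and> dist x (h v) \<le> r / 2} \<subseteq> J"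
        by blast
      from bchoice[OF this] obtain J where J: "\<And>p. p \<in> range g \<Longrightarrow> J p \<in> sets lborel" "\<And>p. p \<in> range g \<Longrightarrow> emeasure lborel (J p) \<noteq> \<infinity>"
        "\<And>p. p \<in> range g \<Longrightarrow> measure lborel (J p) \<le> 1 / m"
        "\<And>p. p \<in> range g \<Longrightarrow> {v\<in>{0..<1}. g v = p \<and> dist x (h v) \<le> r / 2} \<subseteq> J p"
        by blast
      have "{v\<in>{0..<1}. dist x (h v) \<le> r / 2} \<subseteq> (\<Union>p\<in>range g. J p)" using J(4) by blast
      then have "measure lborel {v\<in>{0..<1}. dist x (h v) \<le> r / 2} \<le> measure lborel (\<Union>p\<in>range g. J p)"
        using J(1,2) g(2) by (intro measure_mono_fmeasurable fmeasurable.finite_UN) (auto simp: fmeasurable_def less_top)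
      also have "\<dots> \<le> (\<Sum>p\<in>range g. measure lborel (J p))"
        by (rule measure_UNION_le) (use J(1) g(2) in auto)
      also have "\<dots> \<le> (\<Sum>p\<in>range g. r powr s)" using J(3) mr by (intro sum_mono) (metis order_trans)
      finally show ?thesis by simp
    qed
    have "range h \<subseteq> U \<inter> F" "\<And>v. dist (h v) (g v) < \<epsilon>"
      using hP P by (fastforce simp: dist_commute)+
    then show ?case using hm fin bound by blast
  qed
qed

definition simple_family :: "'a::euclidean_space set \<Rightarrow> (nat \<Rightarrow> 'a set) \<Rightarrow> (nat \<Rightarrow> real \<Rightarrow> 'a) \<Rightarrow> bool" where
  "simple_family F U g \<longleftrightarrow> (\<forall>j. g j \<in> borel_measurable borel \<and> finite (range (g j)) \<and> range (g j) \<subseteq> U j \<inter> F)"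

text \<open>
  With \<open>r = (R k)\<^bsup>-b\<^esup>\<close> the bound of \<open>refine_simple_function\<close> is a constant times \<open>(R k)\<^bsup>-b s\<^esup>\<close>, and
  \<open>t < b s\<close> leaves room for the constant. Only finitely many members of the family can be treated at the same scale.
\<close>

lemma refine_simple_family:
  fixes F :: "'a::euclidean_space set" and R :: "nat \<Rightarrow> real"
  assumes spread: "locally_spread s F" and U: "\<And>j. open (U j)" and \<epsilon>: "\<epsilon> > 0"
    and R: "filterlim R at_top sequentially" and b: "b > 0" "t < b * s"
    and g: "simple_family F U g"
  shows "\<forall>\<^sub>F k in sequentially. \<exists>h. simple_family F U h \<and> (\<forall>j v. dist (h j v) (g j v) < \<epsilon>) \<and>
    (\<forall>j\<le>n. \<forall>x. measure lborel {v\<in>{0..<1}. dist x (h j v) \<le> R k powr - b / 2} \<le> R k powr - t)"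
proof -
  let ?ok = "\<lambda>r j h. h \<in> borel_measurable borel \<and> finite (range h) \<and> range h \<subseteq> U j \<inter> F \<and>
    (\<forall>v. dist (h v) (g j v) < \<epsilon>) \<and>
    (\<forall>x. measure lborel {v\<in>{0..<1}. dist x (h v) \<le> r / 2} \<le> card (range (g j)) * r powr s)"
  define C where "C = (\<Sum>j\<le>n. real (card (range (g j))))"
  have "\<forall>\<^sub>F r in at_right 0. \<forall>j\<in>{..n}. \<exists>h. ?ok r j h"
    using g unfolding simple_family_def
    by (intro eventually_ball_finite ballI refine_simple_function[OF spread U \<epsilon>]) auto
  moreover have "filterlim (\<lambda>k. R k powr - b) (at_right 0) sequentially"
    using b(1) by (intro filterlim_compose[OF _ R]) real_asymp
  ultimately have "\<forall>\<^sub>F k in sequentially. \<forall>j\<in>{..n}. \<exists>h. ?ok (R k powr - b) j h"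
    by (rule eventually_compose_filterlim)
  moreover have "((\<lambda>x::real. x powr (t - b * s)) \<longlongrightarrow> 0) at_top" using b(2) by real_asymp
  then have "((\<lambda>k. C * R k powr (t - b * s)) \<longlongrightarrow> C * 0) sequentially"
    by (intro tendsto_mult_left filterlim_compose[OF _ R])
  then have "\<forall>\<^sub>F k in sequentially. C * R k powr (t - b * s) < 1"
    by (rule order_tendstoD) simp
  moreover have "\<forall>\<^sub>F k in sequentially. R k > 0" using R by (simp add: filterlim_at_top_dense)
  ultimately show ?thesis
  proof eventually_elim
    case (elim k)
    from bchoice[OF elim(1)] obtain h' where all: "\<forall>j\<in>{..n}. ?ok (R k powr - b) j (h' j)" ..
    have h': "?ok (R k powr - b) j (h' j)" if "j \<le> n" for j
      by (rule bspec[OF all]) (simp add: that)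
    define h where "h j = (if j \<le> n then h' j else g j)" for j
    have "measure lborel {v\<in>{0..<1}. dist x (h j v) \<le> R k powr - b / 2} \<le> R k powr - t" if j: "j \<le> n" for j x
    proof -
      have "real (card (range (g j))) \<le> C"
        unfolding C_def using j by (intro member_le_sum[where f="\<lambda>j. real (card (range (g j)))"]) auto
      then have "real (card (range (g j))) * (R k powr - b) powr s \<le> C * (R k powr - b) powr s"
        by (intro mult_right_mono) auto
      also have "\<dots> = (C * R k powr (t - b * s)) * R k powr - t"
        by (simp add: powr_powr flip: powr_add)
      also have "\<dots> \<le> 1 * R k powr - t" using elim by (intro mult_right_mono) auto
      finally show ?thesis using h'[OF j] j by (auto simp: h_def intro: order_trans)
    qed
    moreover have "simple_family F U h" using g h' by (auto simp: simple_family_def h_def)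
    moreover have "dist (h j v) (g j v) < \<epsilon>" for j v using h' \<epsilon> by (simp add: h_def)
    ultimately show ?case by blast
  qed
qed

section \<open>Limits of simple functions and mixtures of their laws\<close>

text \<open>
  Refine again and again, treating the members up to \<open>n\<close> in step \<open>n\<close>. Each step moves the values by at most
  a sixteenth of the previous scale, and the scales at least halve, so all later movement together is at most an
  eighth of the current scale: balls of a quarter of the scale about any point lie, for the limit, within
  balls of half the scale for the current function.
\<close>

lemma spread_limit_family:
  fixes F :: "'a::euclidean_space set" and R :: "nat \<Rightarrow> real"
  assumes F: "compact F" and spread: "locally_spread s F"
    and U: "\<And>j. open (U j)" "\<And>j. U j \<inter> F \<noteq> {}"
    and R: "filterlim R at_top sequentially" and b: "b > 0" "t < b * s"
  obtains G :: "nat \<Rightarrow> real \<Rightarrow> 'a" and \<kappa> :: "nat \<Rightarrow> nat" where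
    "\<forall>j. G j \<in> borel_measurable borel \<and> (\<forall>v. G j v \<in> closure (U j) \<inter> F)"
    "\<forall>n. n \<le> \<kappa> n \<and> 0 < R (\<kappa> n)"
    "\<forall>n. \<forall>j\<le>n. \<forall>x. measure lborel {v\<in>{0..<1}. dist x (G j v) \<le> R (\<kappa> n) powr - b / 4} \<le> R (\<kappa> n) powr - t"
proof -
  define \<rho> where "\<rho> k = R k powr - b" for k
  define small where "small n h k \<longleftrightarrow> (\<forall>j\<le>n. \<forall>x. measure lborel {v\<in>{0..<1}. dist x (h j v) \<le> \<rho> k / 2} \<le> R k powr - t)"
    for n k and h :: "nat \<Rightarrow> real \<Rightarrow> 'a"
  define P where "P n p \<longleftrightarrow> simple_family F U (fst p) \<and> n \<le> snd p \<and> 0 < R (snd p) \<and> small n (fst p) (snd p)"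
    for n and p :: "(nat \<Rightarrow> real \<Rightarrow> 'a) \<times> nat"
  define Q where "Q p q \<longleftrightarrow> (\<forall>j v. dist (fst q j v) (fst p j v) \<le> \<rho> (snd p) / 16) \<and> \<rho> (snd q) \<le> \<rho> (snd p) / 2"
    for p q :: "(nat \<Rightarrow> real \<Rightarrow> 'a) \<times> nat"
  have step: "\<exists>h k. P n (h, k) \<and> (\<forall>j v. dist (h j v) (g j v) < \<epsilon>) \<and> \<rho> k < \<delta>"
    if g: "simple_family F U g" and \<epsilon>: "\<epsilon> > 0" and \<delta>: "\<delta> > 0" for g n \<epsilon> \<delta>
  proof -
    have "((\<lambda>x::real. x powr - b) \<longlongrightarrow> 0) at_top" using b(1) by real_asymp
    then have "(\<rho> \<longlongrightarrow> 0) sequentially" unfolding \<rho>_def by (rule filterlim_compose[OF _ R])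
    then have "\<forall>\<^sub>F k in sequentially. \<rho> k < \<delta>" by (rule order_tendstoD) (rule \<delta>)
    moreover have "\<forall>\<^sub>F k in sequentially. R k > 0" using R by (simp add: filterlim_at_top_dense)
    moreover have "\<forall>\<^sub>F k in sequentially. n \<le> k" by (rule eventually_ge_at_top)
    moreover note refine_simple_family[OF spread U(1) \<epsilon> R b g, of n]
    ultimately have "\<forall>\<^sub>F k in sequentially. \<exists>h. P n (h, k) \<and> (\<forall>j v. dist (h j v) (g j v) < \<epsilon>) \<and> \<rho> k < \<delta>"
      unfolding P_def small_def \<rho>_def fst_conv snd_conv by eventually_elim blast
    from eventually_happens'[OF _ this] show ?thesis by auto
  qed
  have "\<forall>j. \<exists>x. x \<in> U j \<inter> F" using U(2) by blast
  from choice[OF this] obtain x0 where x0: "\<And>j. x0 j \<in> U j \<inter> F" by blast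
  have init: "simple_family F U (\<lambda>j v. x0 j)" using x0 by (auto simp: simple_family_def)
  have \<rho>pos: "\<rho> (snd p) > 0" if "P n p" for n p using that by (simp add: P_def \<rho>_def)
  have "\<exists>f. \<forall>n. P n (f n) \<and> Q (f n) (f (Suc n))"
  proof (rule dependent_nat_choice)
    show "\<exists>p. P 0 p" using step[OF init, of 1 1 0] by auto
    fix p n assume p: "P n p"
    have "simple_family F U (fst p)" using p by (simp add: P_def)
    from step[OF this, of "\<rho> (snd p) / 16" "\<rho> (snd p) / 2" "Suc n"] \<rho>pos[OF p]
    obtain h k where "P (Suc n) (h, k)" "\<forall>j v. dist (h j v) (fst p j v) < \<rho> (snd p) / 16" "\<rho> k < \<rho> (snd p) / 2"
      by auto
    then show "\<exists>q. P (Suc n) q \<and> Q p q"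
      by (intro exI[of _ "(h, k)"]) (auto simp: Q_def intro: less_imp_le)
  qed
  then obtain f where f: "\<And>n. P n (f n)" "\<And>n. Q (f n) (f (Suc n))" by blast
  define g where "g n = fst (f n)" for n
  define \<kappa> where "\<kappa> n = snd (f n)" for n
  define \<sigma> where "\<sigma> n = \<rho> (\<kappa> n)" for n
  have \<sigma>: "\<sigma> n > 0" for n using \<rho>pos[OF f(1)] by (simp add: \<sigma>_def \<kappa>_def)
  have g_step: "dist (g (Suc n) j v) (g n j v) \<le> \<sigma> n / 16" and \<sigma>_step: "\<sigma> (Suc n) \<le> \<sigma> n / 2" for n j v
    using f(2)[of n] by (auto simp: Q_def g_def \<sigma>_def \<kappa>_def)
  have gsf: "simple_family F U (g n)" and gsmall: "small n (g n) (\<kappa> n)" and \<kappa>: "n \<le> \<kappa> n" "0 < R (\<kappa> n)" for n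
    using f(1)[of n] by (auto simp: P_def g_def \<kappa>_def)
  \<comment> \<open>The movements after step \<open>n\<close> are dominated by a geometric series with ratio 1/2.\<close>
  have near: "dist (g (n + i) j v) (g n j v) \<le> \<sigma> n / 8" for n i j v
  proof (induction i arbitrary: n)
    case 0
    then show ?case using \<sigma>[of n] by simp
  next
    case (Suc i)
    have "dist (g (n + Suc i) j v) (g n j v) \<le> dist (g (Suc n + i) j v) (g (Suc n) j v) + dist (g (Suc n) j v) (g n j v)"
      using dist_triangle[of "g (n + Suc i) j v" "g n j v" "g (Suc n) j v"] by simp
    also have "\<dots> \<le> \<sigma> (Suc n) / 8 + \<sigma> n / 16" by (intro add_mono Suc.IH g_step)
    also have "\<dots> \<le> \<sigma> n / 8" using \<sigma>_step[of n] by simp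
    finally show ?case .
  qed
  have \<sigma>_le: "\<sigma> n \<le> \<sigma> 0 * (1 / 2) ^ n" for n
  proof (induction n)
    case (Suc n)
    then show ?case using \<sigma>_step[of n] by simp
  qed simp
  have \<sigma>_lim: "\<sigma> \<longlonglongrightarrow> 0"
  proof (rule tendsto_sandwich[OF _ _ tendsto_const])
    show "\<forall>\<^sub>F n in sequentially. 0 \<le> \<sigma> n" "\<forall>\<^sub>F n in sequentially. \<sigma> n \<le> \<sigma> 0 * (1 / 2) ^ n"
      using \<sigma> \<sigma>_le by (auto intro!: always_eventually less_imp_le)
    show "(\<lambda>n. \<sigma> 0 * (1 / 2) ^ n) \<longlonglongrightarrow> 0"
      by (intro tendsto_mult_right_zero LIMSEQ_realpow_zero) auto
  qed
  have "Cauchy (\<lambda>n. g n j v)" for j v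
  proof (rule metric_CauchyI)
    fix e :: real assume "e > 0"
    then have "\<forall>\<^sub>F n in sequentially. \<sigma> n < e" using \<sigma>_lim by (intro order_tendstoD)
    then obtain N where N: "\<sigma> N < e" by (auto simp: eventually_sequentially)
    have "dist (g m j v) (g n j v) < e" if "m \<ge> N" "n \<ge> N" for m n
    proof -
      have "dist (g m j v) (g N j v) \<le> \<sigma> N / 8" "dist (g n j v) (g N j v) \<le> \<sigma> N / 8"
        using near[of N "m - N" j v] near[of N "n - N" j v] that by simp_all
      then have "dist (g m j v) (g n j v) \<le> \<sigma> N / 8 + \<sigma> N / 8"
        using dist_triangle2[of "g m j v" "g n j v" "g N j v"] by linarith
      then show ?thesis using N \<sigma>[of N] by linarith
    qed
    then show "\<exists>M. \<forall>m\<ge>M. \<forall>n\<ge>M. dist (g m j v) (g n j v) < e" by blast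
  qed
  then have "\<exists>L. (\<lambda>n. g n j v) \<longlonglongrightarrow> L" for j v using Cauchy_convergent convergent_def by blast
  then obtain G where G: "\<And>j v. (\<lambda>n. g n j v) \<longlonglongrightarrow> G j v" by metis
  have close: "dist (G j v) (g n j v) \<le> \<sigma> n / 8" for n j v
  proof -
    have "\<forall>\<^sub>F i in sequentially. dist (g n j v) (g (i + n) j v) \<le> \<sigma> n / 8"
      using near[of n] by (simp add: add.commute dist_commute)
    from Lim_dist_ubound[OF trivial_limit_sequentially LIMSEQ_ignore_initial_segment[OF G] this]
    show ?thesis by (simp add: dist_commute)
  qed
  have Gm: "G j \<in> borel_measurable borel" for j
    by (rule borel_measurable_LIMSEQ_metric[OF _ G]) (use gsf in \<open>auto simp: simple_family_def\<close>)
  have GF: "G j v \<in> closure (U j) \<inter> F" for j v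
  proof (rule closed_sequentially[OF _ _ G])
    show "closed (closure (U j) \<inter> F)" using F by (intro closed_Int) (auto intro: compact_imp_closed)
    show "g n j v \<in> closure (U j) \<inter> F" for n
    proof -
      have "range (g n j) \<subseteq> U j \<inter> F" using gsf[of n] by (simp add: simple_family_def)
      then show ?thesis using closure_subset[of "U j"] by blast
    qed
  qed
  have Gsmall: "measure lborel {v\<in>{0..<1}. dist x (G j v) \<le> R (\<kappa> n) powr - b / 4} \<le> R (\<kappa> n) powr - t"
    if j: "j \<le> n" for n j x
  proof -
    have [measurable]: "g n j \<in> borel_measurable borel" using gsf by (simp add: simple_family_def)
    have "measure lborel {v\<in>{0..<1}. dist x (G j v) \<le> \<sigma> n / 4} \<le> measure lborel {v\<in>{0..<1}. dist x (g n j v) \<le> \<sigma> n / 2}"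
    proof (rule measure_mono_fmeasurable)
      show "{v\<in>{0..<1}. dist x (G j v) \<le> \<sigma> n / 4} \<subseteq> {v\<in>{0..<1}. dist x (g n j v) \<le> \<sigma> n / 2}"
      proof safe
        fix v assume "dist x (G j v) \<le> \<sigma> n / 4"
        then show "dist x (g n j v) \<le> \<sigma> n / 2"
          using close[of j v n] dist_triangle[of x "g n j v" "G j v"] \<sigma>[of n] by linarith
      qed
      show "{v\<in>{0..<1}. dist x (G j v) \<le> \<sigma> n / 4} \<in> sets lborel" using Gm[of j] by measurable
      show "{v\<in>{0..<1}. dist x (g n j v) \<le> \<sigma> n / 2} \<in> fmeasurable lborel"
      proof (rule fmeasurableI2)
        show "{0..1::real} \<in> fmeasurable lborel" by (simp add: fmeasurable_def)
        show "{v\<in>{0..<1}. dist x (g n j v) \<le> \<sigma> n / 2} \<subseteq> {0..1}" by auto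
        show "{v\<in>{0..<1}. dist x (g n j v) \<le> \<sigma> n / 2} \<in> sets lborel" by measurable
      qed
    qed
    also have "\<dots> \<le> R (\<kappa> n) powr - t" using gsmall[of n] j by (simp add: small_def \<sigma>_def)
    finally show ?thesis by (simp add: \<sigma>_def \<rho>_def)
  qed
  show thesis
    by (rule that[of G \<kappa>]) (use Gm GF \<kappa> Gsmall in auto)
qed

text \<open>
  A geometric sequence damped by the running minimum of the prescribed bounds.
\<close>

lemma positive_weights_with_small_tails:
  fixes w :: "nat \<Rightarrow> real"
  assumes w: "\<And>n. w n > 0"
  obtains \<eta> :: "nat \<Rightarrow> real" where "\<forall>j. \<eta> j > 0" "summable \<eta>" "\<forall>n. (\<Sum>j. \<eta> (j + Suc n)) \<le> w n"
proof -
  define \<eta> where "\<eta> j = (1 / 2) ^ Suc j * Min (insert 1 (w ` {..j}))" for j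
  have pos: "\<eta> j > 0" for j using w by (simp add: \<eta>_def)
  have half: "summable (\<lambda>j. (1 / 2 :: real) ^ Suc j)" "(\<Sum>j. (1 / 2 :: real) ^ Suc j) = 1"
    using power_half_series by (auto simp: sums_iff)
  have "\<eta> j \<le> (1 / 2) ^ Suc j * 1" for j unfolding \<eta>_def by (intro mult_left_mono Min_le) auto
  then have sum: "summable \<eta>"
    using pos by (intro summable_comparison_test'[OF half(1), of 0]) (auto simp: less_imp_le)
  have "(\<Sum>j. \<eta> (j + Suc n)) \<le> w n" for n
  proof -
    have "\<eta> (j + Suc n) \<le> (1 / 2) ^ Suc j * w n" for j
      unfolding \<eta>_def
    proof (rule mult_mono)
      show "(1 / 2 :: real) ^ Suc (j + Suc n) \<le> (1 / 2) ^ Suc j" by (rule power_decreasing) auto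
      show "Min (insert 1 (w ` {..j + Suc n})) \<le> w n" by (intro Min_le) auto
      show "0 \<le> Min (insert 1 (w ` {..j + Suc n}))" using w by (simp add: less_imp_le)
    qed simp
    then have "(\<Sum>j. \<eta> (j + Suc n)) \<le> (\<Sum>j. (1 / 2) ^ Suc j * w n)"
      by (intro suminf_le summable_mult2 half(1) summable_ignore_initial_segment sum)
    also have "\<dots> = w n" using suminf_mult2[OF half(1), of "w n"] half(2) by simp
    finally show ?thesis .
  qed
  with pos sum show thesis by (intro that[of \<eta>]) auto
qed

lemma measure_unit_interval_vimage_le_1:
  fixes g :: "real \<Rightarrow> 'a::topological_space"
  assumes g: "g \<in> borel_measurable borel" and A: "A \<in> sets borel"
  shows "measure lborel {v\<in>{0..<1}. g v \<in> A} \<le> 1"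
proof -
  have "{v\<in>{0..<1}. g v \<in> A} \<in> sets lborel" using g A by measurable
  then have "measure lborel {v\<in>{0..<1}. g v \<in> A} \<le> measure lborel {0..1::real}"
    by (intro measure_mono_fmeasurable) (auto simp: fmeasurable_def)
  then show ?thesis by simp
qed

text \<open>
  The mixture is the image of the product of the weighted counting measure with Lebesgue measure on \<open>[0,1)\<close>
  under \<open>(j, v) \<mapsto> G j v\<close>.
\<close>

lemma mixture_of_laws:
  fixes G :: "nat \<Rightarrow> real \<Rightarrow> 'a::euclidean_space"
  assumes G: "\<And>j. G j \<in> borel_measurable borel" and \<eta>: "\<And>j. \<eta> j \<ge> 0" "summable \<eta>"
  obtains \<mu> where "finite_borel_measure \<mu>"
    "\<forall>A\<in>sets borel. measure \<mu> A = (\<Sum>j. \<eta> j * measure lborel {v\<in>{0..<1}. G j v \<in> A})"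
proof -
  define N where "N = density (count_space UNIV) (\<lambda>j::nat. ennreal (\<eta> j))"
  define L where "L = density lborel (indicator {0..<1::real})"
  have setsL: "sets L = sets borel" and setsN: "sets N = sets (count_space UNIV)" by (simp_all add: L_def N_def)
  have emL: "emeasure L B = emeasure lborel ({0..<1} \<inter> B)" if "B \<in> sets borel" for B
    using that by (simp add: L_def emeasure_density indicator_inter_arith[symmetric])
  interpret L: finite_measure L
    by (rule finite_measureI) (use emL[of UNIV] in \<open>simp add: L_def\<close>)
  define \<mu> where "\<mu> = distr (N \<Otimes>\<^sub>M L) borel (\<lambda>(j, v). G j v)"
  have Gm: "(\<lambda>(j, v). G j v) \<in> borel_measurable (N \<Otimes>\<^sub>M L)"
  proof -
    have "(\<lambda>(j, v). G j v) \<in> borel_measurable (count_space UNIV \<Otimes>\<^sub>M borel)"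
      by (rule measurable_pair_measure_countable1) (auto intro: G)
    then show ?thesis
      by (simp add: measurable_cong_sets[OF sets_pair_measure_cong[OF setsN setsL] refl])
  qed
  note le1 = measure_unit_interval_vimage_le_1[OF G]
  have em1: "emeasure lborel {v\<in>{0..<1}. G j v \<in> A} = ennreal (measure lborel {v\<in>{0..<1}. G j v \<in> A})" for j A
  proof (rule emeasure_eq_ennreal_measure)
    have "emeasure lborel {v\<in>{0..<1}. G j v \<in> A} \<le> emeasure lborel {0..1::real}"
      by (intro emeasure_mono) auto
    then show "emeasure lborel {v\<in>{0..<1}. G j v \<in> A} \<noteq> top" by (auto simp: top_unique)
  qed
  have summ: "summable (\<lambda>j. \<eta> j * measure lborel {v\<in>{0..<1}. G j v \<in> A})" if "A \<in> sets borel" for A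
    using \<eta> le1[OF that] by (intro summable_comparison_test'[OF \<eta>(2), of 0]) (auto simp: mult_left_le)
  have em: "emeasure \<mu> A = ennreal (\<Sum>j. \<eta> j * measure lborel {v\<in>{0..<1}. G j v \<in> A})" if A: "A \<in> sets borel" for A
  proof -
    let ?X = "(\<lambda>(j, v). G j v) -` A \<inter> space (N \<Otimes>\<^sub>M L)"
    have X: "?X \<in> sets (N \<Otimes>\<^sub>M L)" using Gm A by (rule measurable_sets)
    have sl: "Pair j -` ?X = G j -` A" for j by (auto simp: space_pair_measure N_def L_def)
    have "emeasure \<mu> A = emeasure (N \<Otimes>\<^sub>M L) ?X" unfolding \<mu>_def by (rule emeasure_distr[OF Gm A])
    also have "\<dots> = (\<integral>\<^sup>+ j. emeasure L (G j -` A) \<partial>N)"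
      by (subst L.emeasure_pair_measure_alt[OF X]) (simp only: sl)
    also have "\<dots> = (\<integral>\<^sup>+ j. ennreal (\<eta> j) * emeasure L (G j -` A) \<partial>count_space UNIV)"
      unfolding N_def by (rule nn_integral_density) auto
    also have "\<dots> = (\<Sum>j. ennreal (\<eta> j) * emeasure L (G j -` A))" by (rule nn_integral_count_space_nat)
    also have "\<dots> = (\<Sum>j. ennreal (\<eta> j * measure lborel {v\<in>{0..<1}. G j v \<in> A}))"
    proof (rule suminf_cong)
      fix j
      have "emeasure L (G j -` A) = emeasure lborel {v\<in>{0..<1}. G j v \<in> A}"
        using measurable_sets_borel[OF G A] by (subst emL) (auto intro!: arg_cong[where f="emeasure lborel"])
      then show "ennreal (\<eta> j) * emeasure L (G j -` A) = ennreal (\<eta> j * measure lborel {v\<in>{0..<1}. G j v \<in> A})"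
        using \<eta>(1)[of j] by (simp only: em1 ennreal_mult measure_nonneg)
    qed
    also have "\<dots> = ennreal (\<Sum>j. \<eta> j * measure lborel {v\<in>{0..<1}. G j v \<in> A})"
      using \<eta>(1) summ[OF A] by (intro suminf_ennreal2) auto
    finally show ?thesis .
  qed
  show thesis
  proof
    have "sets \<mu> = sets borel" "space \<mu> = UNIV" by (simp_all add: \<mu>_def)
    then show "finite_borel_measure \<mu>"
      using em[of UNIV] unfolding finite_borel_measure_def by (auto intro!: finite_measureI)
    show "\<forall>A\<in>sets borel. measure \<mu> A = (\<Sum>j. \<eta> j * measure lborel {v\<in>{0..<1}. G j v \<in> A})"
    proof
      fix A :: "'a set" assume A: "A \<in> sets borel"
      show "measure \<mu> A = (\<Sum>j. \<eta> j * measure lborel {v\<in>{0..<1}. G j v \<in> A})"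
        using em[OF A] \<eta>(1) by (intro measure_eq_emeasure_eq_ennreal suminf_nonneg summ A) auto
    qed
  qed
qed

section \<open>Measures with small energy and the dimension formula\<close>

text \<open>
  The bound from \<open>gaussian_energy_le_of_ball_bound\<close> at \<open>\<rho> = x\<^bsup>-b\<^esup> / 4\<close>: since \<open>b < 1\<close>, the product
  \<open>x \<rho>\<close> is a positive power of \<open>x\<close>, and the Gaussian tail is smaller than every power.
\<close>

lemma eventually_upper_energy_asymptotics:
  fixes m c C t t' b :: real
  assumes "t < t'" "b < 1"
  shows "eventually (\<lambda>x::real. C * (m * (c * x powr - t' + m * exp (- (x * (x powr - b / 4))\<^sup>2 / 2))) \<le> x powr - t) at_top"
proof -
  have "((\<lambda>x::real. x powr (t - t')) \<longlongrightarrow> 0) at_top" using assms(1) by real_asymp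
  moreover have "((\<lambda>x::real. x powr t * exp (- (x powr (1 - b) / 4)\<^sup>2 / 2)) \<longlongrightarrow> 0) at_top"
    using assms(2) by real_asymp
  ultimately have "((\<lambda>x::real. C * m * c * x powr (t - t') + C * m * m * (x powr t * exp (- (x powr (1 - b) / 4)\<^sup>2 / 2)))
      \<longlongrightarrow> C * m * c * 0 + C * m * m * 0) at_top"
    by (intro tendsto_intros)
  then have "\<forall>\<^sub>F x::real in at_top. C * m * c * x powr (t - t') + C * m * m * (x powr t * exp (- (x powr (1 - b) / 4)\<^sup>2 / 2)) < 1"
    by (rule order_tendstoD) simp
  moreover have "eventually (\<lambda>x::real. x > 0) at_top" by (rule eventually_gt_at_top)
  ultimately show ?thesis
  proof eventually_elim
    case (elim x)
    have q: "x * (x powr - b / 4) = x powr (1 - b) / 4" using elim by (simp add: powr_diff powr_minus field_simps)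
    have "C * (m * (c * x powr - t' + m * exp (- (x powr (1 - b) / 4)\<^sup>2 / 2)))
      = (C * m * c * x powr (t - t') + C * m * m * (x powr t * exp (- (x powr (1 - b) / 4)\<^sup>2 / 2))) * x powr - t"
      using elim by (simp add: powr_diff powr_minus field_simps)
    also have "\<dots> \<le> 1 * x powr - t" using elim by (intro mult_right_mono) auto
    finally show ?case unfolding q by simp
  qed
qed

lemma countable_open_neighbourhoods:
  fixes F :: "'a::euclidean_space set"
  assumes F: "F \<noteq> {}"
  obtains U :: "nat \<Rightarrow> 'a set" where "\<forall>j. open (U j) \<and> U j \<inter> F \<noteq> {}"
    "\<forall>V. open V \<longrightarrow> V \<inter> F \<noteq> {} \<longrightarrow> (\<exists>j. closure (U j) \<subseteq> V)"
proof -
  obtain \<B> :: "'a set set" where \<B>: "countable \<B>" "topological_basis \<B>"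
    using ex_countable_basis by blast
  define \<B>' where "\<B>' = {U\<in>\<B>. U \<inter> F \<noteq> {}}"
  have basis: "\<exists>U\<in>\<B>'. x \<in> U \<and> U \<subseteq> V" if "open V" "x \<in> V" "x \<in> F" for V x
    using topological_basisE[OF \<B>(2) that(1,2)] that(3) unfolding \<B>'_def by (metis (mono_tags, lifting) IntI empty_iff mem_Collect_eq)
  have ne: "\<B>' \<noteq> {}" using F basis[of UNIV] by auto
  have cnt: "countable \<B>'" using \<B>(1) by (simp add: \<B>'_def)
  define U where "U = from_nat_into \<B>'"
  have range: "range U = \<B>'" unfolding U_def by (rule range_from_nat_into[OF ne cnt])
  show thesis
  proof
    show "\<forall>j. open (U j) \<and> U j \<inter> F \<noteq> {}"
      using range topological_basis_open[OF \<B>(2)] unfolding \<B>'_def by auto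
    show "\<forall>V. open V \<longrightarrow> V \<inter> F \<noteq> {} \<longrightarrow> (\<exists>j. closure (U j) \<subseteq> V)"
    proof (intro allI impI)
      fix V :: "'a set" assume "open V" "V \<inter> F \<noteq> {}"
      then obtain x where V: "open V" "x \<in> V" "x \<in> F" by blast
      obtain e where e: "e > 0" "cball x e \<subseteq> V" using V by (meson open_contains_cball)
      obtain W where W: "W \<in> \<B>'" "W \<subseteq> ball x e" using basis[of "ball x e" x] e(1) V(3) by auto
      then obtain j where "W = U j" using range by auto
      moreover have "closure W \<subseteq> cball x e" using closure_mono[OF W(2)] e(1) by simp
      ultimately show "\<exists>j. closure (U j) \<subseteq> V" using e(2) by blast
    qed
  qed
qed

text \<open>
  Positive weights on limit functions with values in a neighbourhood basis of \<open>F\<close> force the support to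
  be all of \<open>F\<close>. At the \<open>n\<close>-th chosen scale the members up to \<open>n\<close> are spread out, and the weights
  are chosen after the scales so that the remaining members have negligible mass.
\<close>

lemma measure_spreading_along_scales:
  fixes F :: "'a::euclidean_space set" and R :: "nat \<Rightarrow> real"
  assumes F: "compact F" "F \<noteq> {}" and spread: "locally_spread s F"
    and R: "filterlim R at_top sequentially" and b: "b > 0" "t < b * s"
  obtains \<mu> :: "'a measure" and c where "finite_borel_measure \<mu>" "spt \<mu> = F"
    "\<forall>n. \<exists>k\<ge>n. 0 < R k \<and> (\<forall>x. measure \<mu> (cball x (R k powr - b / 4)) \<le> c * R k powr - t)"
proof -
  obtain U :: "nat \<Rightarrow> 'a set" where "\<forall>j. open (U j) \<and> U j \<inter> F \<noteq> {}"
    and U_sub: "\<forall>V. open V \<longrightarrow> V \<inter> F \<noteq> {} \<longrightarrow> (\<exists>j. closure (U j) \<subseteq> V)"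
    by (rule countable_open_neighbourhoods[OF F(2)])
  then have U: "open (U j)" "U j \<inter> F \<noteq> {}" for j by simp_all
  obtain G :: "nat \<Rightarrow> real \<Rightarrow> 'a" and \<kappa> :: "nat \<Rightarrow> nat" where "\<forall>j. G j \<in> borel_measurable borel \<and> (\<forall>v. G j v \<in> closure (U j) \<inter> F)"
    and \<kappa>: "\<forall>n. n \<le> \<kappa> n \<and> 0 < R (\<kappa> n)"
    and small: "\<forall>n. \<forall>j\<le>n. \<forall>x. measure lborel {v\<in>{0..<1}. dist x (G j v) \<le> R (\<kappa> n) powr - b / 4} \<le> R (\<kappa> n) powr - t"
    by (rule spread_limit_family[OF F(1) spread U R b])
  then have G: "G j \<in> borel_measurable borel" "G j v \<in> closure (U j) \<inter> F" for j v by simp_all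
  have w: "R (\<kappa> n) powr - t > 0" for n using \<kappa> by (simp add: less_imp_neq[symmetric])
  obtain \<eta> :: "nat \<Rightarrow> real" where \<eta>_pos: "\<forall>j. \<eta> j > 0" and \<eta>_summable: "summable \<eta>"
    and \<eta>_tail: "\<forall>n. (\<Sum>j. \<eta> (j + Suc n)) \<le> R (\<kappa> n) powr - t"
    by (rule positive_weights_with_small_tails[OF w])
  note \<eta> = \<eta>_pos[rule_format] \<eta>_summable \<eta>_tail[rule_format]
  obtain \<mu> where mu: "finite_borel_measure \<mu>"
    and mu_all: "\<forall>A\<in>sets borel. measure \<mu> A = (\<Sum>j. \<eta> j * measure lborel {v\<in>{0..<1}. G j v \<in> A})"
    by (rule mixture_of_laws[of G \<eta>, OF G(1) less_imp_le[OF \<eta>(1)] \<eta>(2)])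
  note mu_eq = mu_all[rule_format]
  interpret finite_measure \<mu> using mu by (simp add: finite_borel_measure_def)
  note le1 = measure_unit_interval_vimage_le_1[OF G(1)]
  have summ: "summable (\<lambda>j. \<eta> j * measure lborel {v\<in>{0..<1}. G j v \<in> A})" if "A \<in> sets borel" for A
    using \<eta>(1) le1[OF that]
    by (intro summable_comparison_test'[OF \<eta>(2), of 0]) (auto simp: mult_left_le less_imp_le)
  have "spt \<mu> = F"
  proof (intro set_eqI iffI)
    fix x assume x: "x \<in> F"
    have "emeasure \<mu> V > 0" if V: "open V" "x \<in> V" for V
    proof -
      obtain j where j: "closure (U j) \<subseteq> V" using U_sub V x by blast
      have "{v\<in>{0..<1}. G j v \<in> V} = {0..<1}" using G(2)[of j] j by auto
      then have "\<eta> j \<le> measure \<mu> V"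
        using sum_le_suminf[OF summ, of V "{j}"] V(1) \<eta>(1) by (simp add: mu_eq less_imp_le)
      then show ?thesis using \<eta>(1)[of j] by (simp add: emeasure_eq_measure)
    qed
    then show "x \<in> spt \<mu>" by (simp add: spt_def)
  next
    fix x assume x: "x \<in> spt \<mu>"
    show "x \<in> F"
    proof (rule ccontr)
      assume "x \<notin> F"
      moreover have "open (- F)" using F(1) by (simp add: compact_imp_closed open_Compl)
      ultimately have "emeasure \<mu> (- F) > 0" using x by (simp add: spt_def)
      moreover have "measure \<mu> (- F) = 0"
      proof -
        have empty: "{v\<in>{0..<1}. G j v \<in> - F} = {}" for j using G(2)[of j] by auto
        have "- F \<in> sets borel" using \<open>open (- F)\<close> by simp
        from mu_eq[OF this] show ?thesis unfolding empty by simp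
      qed
      ultimately show False by (simp add: emeasure_eq_measure)
    qed
  qed
  moreover have "measure \<mu> (cball x (R (\<kappa> n) powr - b / 4)) \<le> (1 + suminf \<eta>) * R (\<kappa> n) powr - t" for n x
  proof -
    define B where "B = cball x (R (\<kappa> n) powr - b / 4)"
    have B: "B \<in> sets borel" by (simp add: B_def)
    let ?a = "\<lambda>j. \<eta> j * measure lborel {v\<in>{0..<1}. G j v \<in> B}"
    have "measure \<mu> B = (\<Sum>j. ?a (j + Suc n)) + (\<Sum>j<Suc n. ?a j)"
      unfolding mu_eq[OF B] by (rule suminf_split_initial_segment[OF summ[OF B]])
    moreover have "(\<Sum>j. ?a (j + Suc n)) \<le> (\<Sum>j. \<eta> (j + Suc n))"
      using \<eta>(1) le1[OF B]
      by (intro suminf_le summable_ignore_initial_segment[OF summ[OF B]] summable_ignore_initial_segment \<eta>(2))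
        (auto simp: mult_left_le less_imp_le)
    moreover have "(\<Sum>j<Suc n. ?a j) \<le> (\<Sum>j<Suc n. \<eta> j * R (\<kappa> n) powr - t)"
      using small \<eta>(1) by (intro sum_mono mult_left_mono) (auto simp: B_def less_imp_le)
    moreover have "(\<Sum>j<Suc n. \<eta> j * R (\<kappa> n) powr - t) \<le> suminf \<eta> * R (\<kappa> n) powr - t"
      unfolding sum_distrib_right[symmetric] using \<eta>(1,2)
      by (intro mult_right_mono sum_le_suminf) (auto simp: less_imp_le)
    ultimately have "measure \<mu> B \<le> R (\<kappa> n) powr - t + suminf \<eta> * R (\<kappa> n) powr - t"
      using \<eta>(3)[of n] by linarith
    then show ?thesis by (simp add: B_def algebra_simps)
  qed
  ultimately show thesis using mu \<kappa> by (intro that[of \<mu> "1 + suminf \<eta>"]) blast+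
qed

text \<open>
  The loss in passing from \<open>R\<close> to \<open>R\<^bsup>b\<^esup>\<close> with \<open>b < 1\<close> pays for the Gaussian tail, and \<open>b\<close> can be taken so
  close to 1 that \<open>t < b s\<close> still holds. The limit superior asks for good frequencies only infinitely often.
\<close>

lemma fourier_decay_limsup_ge:
  fixes F :: "'a::euclidean_space set" and R :: "nat \<Rightarrow> real"
  assumes F: "compact F" "F \<noteq> {}" and spread: "locally_spread s F" and t: "t < s"
    and R: "filterlim R at_top sequentially"
  obtains \<mu> :: "'a measure" where "finite_borel_measure \<mu>" "spt \<mu> = F"
    "ereal t \<le> limsup (\<lambda>k. ereal (fourier_decay_exponent (R k) \<mu>))"
proof -
  \<comment> \<open>Letting \<open>b\<close> tend to 1 from below treats all signs of \<open>s\<close> alike.\<close>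
  have "((\<lambda>b. b * s) \<longlongrightarrow> 1 * s) (at_left 1)" by (intro tendsto_intros)
  then have "\<forall>\<^sub>F b in at_left 1. t < b * s" using t by (intro order_tendstoD) auto
  moreover have "\<forall>\<^sub>F b::real in at_left 1. b \<in> {0<..<1}" by (rule eventually_at_left_real) simp
  ultimately have "\<forall>\<^sub>F b in at_left 1. t < b * s \<and> 0 < b \<and> b < 1" by eventually_elim auto
  then obtain b where b: "t < b * s" "0 < b" "b < 1"
    using eventually_happens'[OF trivial_limit_at_left_real] by blast
  obtain t' where t': "t < t'" "t' < b * s" using dense[OF b(1)] by blast
  obtain \<mu> :: "'a measure" and c where mu: "finite_borel_measure \<mu>" "spt \<mu> = F"
    and ball: "\<forall>n. \<exists>k\<ge>n. 0 < R k \<and> (\<forall>x. measure \<mu> (cball x (R k powr - b / 4)) \<le> c * R k powr - t')"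
    by (rule measure_spreading_along_scales[OF F spread R b(2) t'(2)])
  define m where "m = measure \<mu> UNIV"
  define C where "C = exp (1 / 2) * sqrt (2 * pi) ^ DIM('a)"
  have C: "C > 0" by (simp add: C_def)
  have "\<forall>\<^sub>F k in sequentially. C * (m * (c * R k powr - t' + m * exp (- (R k * (R k powr - b / 4))\<^sup>2 / 2))) \<le> R k powr - t"
    by (rule eventually_compose_filterlim[OF eventually_upper_energy_asymptotics[OF t'(1) b(3)] R])
  moreover have "\<forall>\<^sub>F k in sequentially. R k > 1" using R by (simp add: filterlim_at_top_dense)
  ultimately have "\<forall>\<^sub>F k in sequentially. R k > 1 \<and> C * (m * (c * R k powr - t' + m * exp (- (R k * (R k powr - b / 4))\<^sup>2 / 2))) \<le> R k powr - t"
    by (rule eventually_conj[rotated])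
  then obtain n0 where n0: "\<And>k. k \<ge> n0 \<Longrightarrow> R k > 1"
    "\<And>k. k \<ge> n0 \<Longrightarrow> C * (m * (c * R k powr - t' + m * exp (- (R k * (R k powr - b / 4))\<^sup>2 / 2))) \<le> R k powr - t"
    unfolding eventually_sequentially by blast
  have freq: "\<exists>k\<ge>n. t \<le> fourier_decay_exponent (R k) \<mu>" for n
  proof -
    obtain k where k: "k \<ge> max n n0" "0 < R k" "\<And>x. measure \<mu> (cball x (R k powr - b / 4)) \<le> c * R k powr - t'"
      using ball by blast
    define E where "E = (LINT z:cball 0 (R k)|lborel. (cmod (fourier \<mu> z))\<^sup>2)"
    have pw: "R k powi (- int DIM('a)) * R k ^ DIM('a) = 1" using k(2) by (simp add: power_int_minus)
    have pos: "R k powi (- int DIM('a)) > 0" using k(2) by simp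
    have Epos: "E > 0" unfolding E_def using fourier_energy_pos[OF mu(1) _ _ k(2)] mu(2) F by simp
    have "gaussian_energy (R k) \<mu> \<le> m * (c * R k powr - t' + m * exp (- (R k * (R k powr - b / 4))\<^sup>2 / 2))"
      unfolding m_def by (rule gaussian_energy_le_of_ball_bound[OF mu(1) k(2)]) (use k in auto)
    then have "C * gaussian_energy (R k) \<mu> \<le> C * (m * (c * R k powr - t' + m * exp (- (R k * (R k powr - b / 4))\<^sup>2 / 2)))"
      using C by simp
    also have "\<dots> \<le> R k powr - t" using n0(2) k(1) by simp
    finally have "C * gaussian_energy (R k) \<mu> \<le> R k powr - t" .
    moreover have "R k powi (- int DIM('a)) * E \<le> R k powi (- int DIM('a)) * (exp (1 / 2) * (R k * sqrt (2 * pi)) ^ DIM('a) * gaussian_energy (R k) \<mu>)"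
      unfolding E_def using pos by (intro mult_left_mono fourier_energy_le mu k) auto
    moreover have "R k powi (- int DIM('a)) * (exp (1 / 2) * (R k * sqrt (2 * pi)) ^ DIM('a) * gaussian_energy (R k) \<mu>)
        = (R k powi (- int DIM('a)) * R k ^ DIM('a)) * (C * gaussian_energy (R k) \<mu>)"
      by (simp only: C_def power_mult_distrib mult_ac)
    ultimately have "R k powi (- int DIM('a)) * E \<le> R k powr - t" unfolding pw by simp
    then have "t \<le> fourier_decay_exponent (R k) \<mu>"
      unfolding fourier_decay_exponent_def E_def[symmetric]
      using n0(1)[of k] k(1) pos Epos by (intro ln_div_neg_ln_ge) auto
    then show ?thesis using k(1) by auto
  qed
  have "ereal t \<le> limsup (\<lambda>k. ereal (fourier_decay_exponent (R k) \<mu>))"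
  proof (rule ccontr)
    assume "\<not> ?thesis"
    then have "\<forall>\<^sub>F k in sequentially. ereal (fourier_decay_exponent (R k) \<mu>) < ereal t"
      by (intro Limsup_lessD) auto
    then obtain N where "\<And>k. k \<ge> N \<Longrightarrow> fourier_decay_exponent (R k) \<mu> < t" by (auto simp: eventually_sequentially)
    then show False using freq[of N] by (meson not_le)
  qed
  with mu that show thesis by blast
qed

text \<open>
  \<open>F\<close> is what remains of \<open>E\<close> after removing all basic open sets whose part of \<open>E\<close> is covered by countably
  many compact sets of dimension at most \<open>s\<close>. The removed part is itself covered in this way, so \<open>F\<close>
  cannot be empty; and a piece of \<open>F\<close> of dimension at most \<open>s\<close> would have been removed.
\<close>

lemma essential_part:
  fixes E :: "'a::euclidean_space set"
  assumes E: "compact E" "E \<noteq> {}" and s: "ereal s < modified_lower_box_dim E"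
  obtains F where "compact F" "F \<noteq> {}" "F \<subseteq> E"
    "\<forall>U. open U \<longrightarrow> U \<inter> F \<noteq> {} \<longrightarrow> ereal s < lower_box_dim (closure (U \<inter> F))"
proof -
  define low where "low K \<longleftrightarrow> compact K \<and> K \<noteq> {} \<and> lower_box_dim K \<le> ereal s" for K :: "'a set"
  define good where "good A \<longleftrightarrow> (\<exists>\<K>. countable \<K> \<and> (\<forall>K\<in>\<K>. low K) \<and> A \<subseteq> \<Union>\<K>)" for A
  have not_good: "\<not> good E"
  proof
    assume "good E"
    then obtain \<K> where \<K>: "countable \<K>" "\<And>K. K \<in> \<K> \<Longrightarrow> low K" "E \<subseteq> \<Union>\<K>" by (auto simp: good_def)
    then have ne: "\<K> \<noteq> {}" using E(2) by auto
    have K: "low (from_nat_into \<K> i)" for i using \<K>(2) from_nat_into[OF ne] by blast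
    have "modified_lower_box_dim E \<le> (SUP i. lower_box_dim (from_nat_into \<K> i))"
      unfolding modified_lower_box_dim_def
      using K \<K>(3) range_from_nat_into[OF ne \<K>(1)] by (intro INF_lower) (auto simp: low_def)
    also have "\<dots> \<le> ereal s" using K by (intro SUP_least) (auto simp: low_def)
    finally show False using s by simp
  qed
  have good_Union: "good (\<Union>\<A>)" if "countable \<A>" "\<And>A. A \<in> \<A> \<Longrightarrow> good A" for \<A>
  proof -
    have "\<forall>A\<in>\<A>. \<exists>\<K>. countable \<K> \<and> (\<forall>K\<in>\<K>. low K) \<and> A \<subseteq> \<Union>\<K>"
      using that(2) by (auto simp: good_def)
    from bchoice[OF this] obtain k where k: "\<forall>A\<in>\<A>. countable (k A) \<and> (\<forall>K\<in>k A. low K) \<and> A \<subseteq> \<Union>(k A)" ..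
    have "countable (\<Union>A\<in>\<A>. k A)" by (intro countable_UN) (use that(1) k in auto)
    moreover have "\<forall>K\<in>(\<Union>A\<in>\<A>. k A). low K" using k by auto
    moreover have "\<Union>\<A> \<subseteq> \<Union>(\<Union>A\<in>\<A>. k A)"
    proof (rule Union_least)
      fix A assume A: "A \<in> \<A>"
      then have "A \<subseteq> \<Union>(k A)" "\<Union>(k A) \<subseteq> \<Union>(\<Union>A\<in>\<A>. k A)" using k by auto
      then show "A \<subseteq> \<Union>(\<Union>A\<in>\<A>. k A)" by (rule order_trans)
    qed
    ultimately show ?thesis unfolding good_def by blast
  qed
  have good_mono: "good A" if "good B" "A \<subseteq> B" for A B using that unfolding good_def by (meson order_trans)
  obtain \<B> :: "'a set set" where \<B>: "countable \<B>" "topological_basis \<B>"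
    using ex_countable_basis by blast
  define \<W> where "\<W> = {V\<in>\<B>. good (E \<inter> V)}"
  define F where "F = E - \<Union>\<W>"
  have "good (\<Union>V\<in>\<W>. E \<inter> V)" by (rule good_Union) (use \<B>(1) in \<open>auto simp: \<W>_def\<close>)
  then have goodW: "good (E \<inter> \<Union>\<W>)" by (rule good_mono) auto
  show thesis
  proof
    have "open (\<Union>\<W>)" using topological_basis_open[OF \<B>(2)] by (intro open_Union) (auto simp: \<W>_def)
    then show F: "compact F" unfolding F_def using E(1) by (intro compact_diff)
    show "F \<subseteq> E" by (simp add: F_def)
    show "F \<noteq> {}"
    proof
      assume "F = {}"
      then have "E \<subseteq> E \<inter> \<Union>\<W>" by (auto simp: F_def)
      then show False using good_mono[OF goodW] not_good by blast
    qed
    show "\<forall>U. open U \<longrightarrow> U \<inter> F \<noteq> {} \<longrightarrow> ereal s < lower_box_dim (closure (U \<inter> F))"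
    proof (intro allI impI)
      fix U :: "'a set" assume U: "open U" "U \<inter> F \<noteq> {}"
      show "ereal s < lower_box_dim (closure (U \<inter> F))"
      proof (rule ccontr)
        assume dim: "\<not> ?thesis"
        obtain x where x: "x \<in> U" "x \<in> F" using U(2) by blast
        obtain V where V: "V \<in> \<B>" "x \<in> V" "V \<subseteq> U" using topological_basisE[OF \<B>(2) U(1) x(1)] by blast
        have "compact (closure (U \<inter> F))"
          using F by (auto simp: compact_closure intro: bounded_subset compact_imp_bounded)
        then have "low (closure (U \<inter> F))"
          using dim U(2) by (auto simp: low_def not_less)
        then have "good (closure (U \<inter> F))"
          unfolding good_def by (intro exI[of _ "{closure (U \<inter> F)}"]) auto
        then have "good (\<Union>{E \<inter> \<Union>\<W>, closure (U \<inter> F)})" using goodW by (intro good_Union) auto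
        moreover have "E \<inter> V \<subseteq> \<Union>{E \<inter> \<Union>\<W>, closure (U \<inter> F)}"
          using V(3) closure_subset[of "U \<inter> F"] by (auto simp: F_def)
        ultimately have "good (E \<inter> V)" by (rule good_mono)
        then have "V \<in> \<W>" using V(1) by (simp add: \<W>_def)
        then show False using x(2) V(2) by (auto simp: F_def)
      qed
    qed
  qed
qed

text \<open>
  The same equality in an arbitrary Euclidean space: both inequalities are obtained by comparing
  with real numbers strictly between the two sides.
\<close>

theorem modified_lower_box_dim_eq_fourier_decay:
  fixes E :: "'a::euclidean_space set"
  assumes E: "compact E" "E \<noteq> {}"
  shows "modified_lower_box_dim E =
    (SUP F \<in> {F. compact F \<and> F \<noteq> {} \<and> F \<subseteq> E}.
      INF R \<in> {R :: nat \<Rightarrow> real. (\<forall>k. 0 < R k) \<and> incseq R \<and> filterlim R at_top sequentially}.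
        SUP \<mu> \<in> {\<mu> :: 'a measure. finite_borel_measure \<mu> \<and> spt \<mu> = F}.
          limsup (\<lambda>k. ereal (fourier_decay_exponent (R k) \<mu>)))"
    (is "_ = (SUP F \<in> ?\<F>. INF R \<in> ?\<R>. SUP \<mu> \<in> ?\<M> F. ?L R \<mu>)")
proof (rule antisym)
  show "modified_lower_box_dim E \<le> (SUP F \<in> ?\<F>. INF R \<in> ?\<R>. SUP \<mu> \<in> ?\<M> F. ?L R \<mu>)"
  proof (rule dense_le)
    fix x assume "x < modified_lower_box_dim E"
    then obtain t where t: "x < ereal t" "ereal t < modified_lower_box_dim E" by (meson ereal_dense2)
    then obtain s where s: "t < s" "ereal s < modified_lower_box_dim E" using ereal_dense2[OF t(2)] by auto
    obtain F where F: "compact F" "F \<noteq> {}" "F \<subseteq> E"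
      "\<forall>U. open U \<longrightarrow> U \<inter> F \<noteq> {} \<longrightarrow> ereal s < lower_box_dim (closure (U \<inter> F))"
      by (rule essential_part[OF E s(2)])
    obtain s' where s': "t < s'" "s' < s" using dense[OF s(1)] by blast
    have spread: "locally_spread s' F" by (rule locally_spread_of_lower_box_dim[OF F(1) s'(2)]) (use F(4) in blast)
    have "ereal t \<le> (INF R \<in> ?\<R>. SUP \<mu> \<in> ?\<M> F. ?L R \<mu>)"
    proof (rule INF_greatest)
      fix R assume "R \<in> ?\<R>"
      then have R: "filterlim R at_top sequentially" by simp
      obtain \<mu> :: "'a measure" where "finite_borel_measure \<mu>" "spt \<mu> = F" "ereal t \<le> ?L R \<mu>"
        by (rule fourier_decay_limsup_ge[OF F(1,2) spread s'(1) R])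
      then have "\<mu> \<in> ?\<M> F" "ereal t \<le> ?L R \<mu>" by simp_all
      then show "ereal t \<le> (SUP \<mu> \<in> ?\<M> F. ?L R \<mu>)" by (rule SUP_upper2)
    qed
    also have "\<dots> \<le> (SUP F \<in> ?\<F>. INF R \<in> ?\<R>. SUP \<mu> \<in> ?\<M> F. ?L R \<mu>)"
      using F by (intro SUP_upper) auto
    finally show "x \<le> (SUP F \<in> ?\<F>. INF R \<in> ?\<R>. SUP \<mu> \<in> ?\<M> F. ?L R \<mu>)" using t(1) by (auto intro: order_trans less_imp_le)
  qed
  show "(SUP F \<in> ?\<F>. INF R \<in> ?\<R>. SUP \<mu> \<in> ?\<M> F. ?L R \<mu>) \<le> modified_lower_box_dim E"
    unfolding modified_lower_box_dim_def
  proof (intro SUP_least INF_greatest)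
    fix F K assume "F \<in> ?\<F>" and "K \<in> {K :: nat \<Rightarrow> 'a set. (\<forall>i. compact (K i) \<and> K i \<noteq> {}) \<and> E \<subseteq> (\<Union>i. K i)}"
    then have F: "compact F" "F \<noteq> {}" "F \<subseteq> (\<Union>i. K i)" and K: "\<And>i. compact (K i)" "\<And>i. K i \<noteq> {}"
      by auto
    obtain i U where U: "open U" "U \<inter> F \<noteq> {}" "U \<inter> F \<subseteq> K i"
      by (rule Baire_countable_closed_cover[OF compact_imp_closed[OF F(1)] F(2) compact_imp_closed[OF K(1)] F(3)])
    have nonneg: "0 \<le> (SUP i. lower_box_dim (K i))"
      using lower_box_dim_nonneg[OF K] by (intro SUP_upper2[of 0]) auto
    show "(INF R \<in> ?\<R>. SUP \<mu> \<in> ?\<M> F. ?L R \<mu>) \<le> (SUP i. lower_box_dim (K i))"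
    proof (rule dense_ge)
      fix y assume "(SUP i. lower_box_dim (K i)) < y"
      then obtain t' where t': "(SUP i. lower_box_dim (K i)) < ereal t'" "ereal t' < y" by (meson ereal_dense2)
      then obtain t where t: "(SUP i. lower_box_dim (K i)) < ereal t" "t < t'" using ereal_dense2[OF t'(1)] by auto
      have "0 \<le> t" using order.strict_trans1[OF nonneg t(1)] by simp
      have "lower_box_dim (K i) < ereal t"
        using t(1) by (rule order.strict_trans1[rotated]) (rule SUP_upper, simp)
      then obtain R where R: "\<forall>k. 0 < R k" "incseq R" "filterlim R at_top sequentially"
        and L: "\<forall>\<mu> :: 'a measure. finite_borel_measure \<mu> \<longrightarrow> spt \<mu> = F \<longrightarrow> ?L R \<mu> \<le> ereal t'"
        by (rule limsup_fourier_decay_le[OF K(1) _ \<open>0 \<le> t\<close> t(2) U])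
      have "(INF R \<in> ?\<R>. SUP \<mu> \<in> ?\<M> F. ?L R \<mu>) \<le> (SUP \<mu> \<in> ?\<M> F. ?L R \<mu>)"
        using R by (intro INF_lower) auto
      also have "\<dots> \<le> ereal t'" using L by (intro SUP_least) auto
      finally show "(INF R \<in> ?\<R>. SUP \<mu> \<in> ?\<M> F. ?L R \<mu>) \<le> y" using t'(2) by (auto intro: order_trans less_imp_le)
    qed
  qed
qed

theorem corollary4p3:
  fixes E :: "(real ^ 'd) set"
  assumes "compact E" and "E \<noteq> {}"
  shows "modified_lower_box_dim E =
    (SUP F \<in> {F. compact F \<and> F \<noteq> {} \<and> F \<subseteq> E}.
      INF R \<in> {R :: nat \<Rightarrow> real. (\<forall>k. 0 < R k) \<and> incseq R \<and> filterlim R at_top sequentially}.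
        SUP \<mu> \<in> {\<mu> :: (real ^ 'd) measure. finite_borel_measure \<mu> \<and> spt \<mu> = F}.
          limsup (\<lambda>k. ereal
            (ln (R k powi (- int CARD('d)) *
                 (LINT z:cball 0 (R k)|lborel. (cmod (fourier \<mu> z))\<^sup>2)) / (- ln (R k)))))"
  using modified_lower_box_dim_eq_fourier_decay[OF assms]
  unfolding fourier_decay_exponent_def DIM_cart DIM_real mult_1_right .

end
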